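(* Let $m\geq 2$ and $n\geq 2$ be integers. Then the normalized Laplacian spectral gap $\gamma(P(m,n))$ of the generalized pancake graph $P(m,n)$ satisfies \[ \frac{\alpha_m}{n}\leq \gamma(P(m,n))\leq \frac{1}{n}, \] where \[ \alpha_m=\begin{cases}1-\cos(\pi/m) & \text{if } m \text{ is odd},\\ \min\{1-\cos(2\pi/m),\,2-\sqrt{2}\} & \text{if } m \text{ is even}.\end{cases} \] In particular, for every fixed $m\geq 2$, $\gamma(P(m,n))=\Theta_m(1/n)$ as $n\to\infty$ (that is, there are positive constants depending only on $m$ such that $\gamma(P(m,n))$ lies between these constants times $1/n$ for all sufficiently large $n$).
   Context: Let $[n]=\{1,\dots,n\}$. $S(m,n)=\mathbb{Z}_m\wr S_n=(\mathbb{Z}_m)^n\rtimes S_n$ is the group of colored permutations, where $S_n$ acts on $(\mathbb{Z}_m)^n$ by $(\sigma\cdot a)_j=a_{\sigma^{-1}(j)}$, so that $(a,\sigma)(b,\tau)=(a+\sigma\cdot b,\sigma\tau)$. For $1\le i\le n$, $r_i\in S_n$ is the permutation with $r_i(j)=i+1-j$ for $j\le i$ and $r_i(j)=j$ for $j>i$ (so $r_1=e$). For $\varepsilon\in\{+,-\}$, let $c_i^{\varepsilon}\in(\mathbb{Z}_m)^n$ be the vector whose first $i$ components are all $\varepsilon 1$ (i.e. $+1$ or $-1$) and whose other components are $0$, and let $r_i^{\varepsilon}=(c_i^{\varepsilon},r_i)\in S(m,n)$. For $m\ge2$ the set of generalized prefix reversals is $R(m,n)=\{r_i^{\varepsilon}:1\le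 i\le n,\ \varepsilon\in\{+,-\}\}$; it is closed under inverses, and has $n$ elements if $m=2$ (since then $r_i^+=r_i^-$) and $2n$ elements if $m\ge3$. The generalized pancake graph $P(m,n)$ is the Cayley graph of $S(m,n)$ with respect to $R(m,n)$: its vertex set is $S(m,n)$ and its edges join $x$ to $s x$ for $s\in R(m,n)$. It is a connected $d$-regular graph with $d=|R(m,n)|$. For a finite $d$-regular graph $\mathcal{G}$ with adjacency matrix $A_{\mathcal G}$, $\gamma(\mathcal G)$ denotes the second smallest eigenvalue (with multiplicity) of the normalized Laplacian $I-\frac1d A_{\mathcal G}$, i.e. $\gamma(\mathcal G)=1-\frac1d\lambda_2(A_{\mathcal G})$, where $\lambda_2$ is the second largest eigenvalue counted with multiplicity. *)

theory Defs
  imports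
    Complex_Main
    "HOL-Algebra.Product_Groups"
    "HOL-Algebra.Sym_Groups"
    "Jordan_Normal_Form.Char_Poly"
begin

section \<open>Finite graphs and the normalized Laplacian gap\<close>

text \<open>A simple graph is a vertex set together with a set of unordered edges \<open>{x, y}\<close>.\<close>

type_synonym 'a graph = "'a set \<times> 'a set set"

definition verts :: "'a graph \<Rightarrow> 'a set" where
  "verts \<G> = fst \<G>"

definition edges :: "'a graph \<Rightarrow> 'a set set" where
  "edges \<G> = snd \<G>"

definition vertex_degree :: "'a graph \<Rightarrow> 'a \<Rightarrow> nat" where
  "vertex_degree \<G> x = card {e \<in> edges \<G>. x \<in> e}"

definition regular_degree :: "'a graph \<Rightarrow> nat" where
  "regular_degree \<G> = (THE d. \<forall>x \<in> verts \<G>. vertex_degree \<G> x = d)"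

text \<open>Matrices are indexed by \<open>{0..<N}\<close>, so the vertices have to be listed in some order.
  Another order conjugates the adjacency matrix by a permutation matrix and so does not affect
  its characteristic polynomial.\<close>

definition vertex_list :: "'a graph \<Rightarrow> 'a list" where
  "vertex_list \<G> = (SOME xs. distinct xs \<and> set xs = verts \<G>)"

definition adjacency_matrix :: "'a graph \<Rightarrow> real mat" where
  "adjacency_matrix \<G> =
     (let xs = vertex_list \<G>; N = length xs
      in mat N N (\<lambda>(i, j). if {xs ! i, xs ! j} \<in> edges \<G> then 1 else 0))"

definition normalized_laplacian :: "'a graph \<Rightarrow> real mat" where
  "normalized_laplacian \<G> =
     (let A = adjacency_matrix \<G>
      in 1\<^sub>m (dim_row A) - (1 / real (regular_degree \<G>)) \<cdot>\<^sub>m A)"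

text \<open>The real eigenvalues of a real matrix in increasing order, each repeated according to its
  algebraic multiplicity. For a symmetric matrix these are all its complex eigenvalues.\<close>

definition eigenvalue_list :: "real mat \<Rightarrow> real list" where
  "eigenvalue_list A = sorted_list_of_multiset (proots (char_poly A))"

text \<open>Entry 1 of the (zero-based) list is the second smallest eigenvalue. The definition is
  meant for finite regular graphs with at least two vertices.\<close>

definition spectral_gap :: "'a graph \<Rightarrow> real" where
  "spectral_gap \<G> = eigenvalue_list (normalized_laplacian \<G>) ! 1"

definition cayley_graph :: "('a, 'b) monoid_scheme \<Rightarrow> 'a set \<Rightarrow> 'a graph" where
  "cayley_graph G S = (carrier G, {{x, s \<otimes>\<^bsub>G\<^esub> x} | x s. x \<in> carrier G \<and> s \<in> S})"


section \<open>Colored permutations and generalized pancake graphs\<close>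

text \<open>Color vectors are functions on \<open>{1..n}\<close> (\<open>undefined\<close> elsewhere), with
  components in \<open>{0..<m}\<close> representing the integers modulo \<open>m\<close>.\<close>

definition color_group :: "nat \<Rightarrow> nat \<Rightarrow> (nat \<Rightarrow> int) monoid" where
  "color_group m n = product_group {1..n} (\<lambda>_. integer_mod_group m)"

definition perm_act :: "nat \<Rightarrow> (nat \<Rightarrow> nat) \<Rightarrow> (nat \<Rightarrow> int) \<Rightarrow> nat \<Rightarrow> int" where
  "perm_act n \<sigma> a = (\<lambda>j\<in>{1..n}. a (inv_into UNIV \<sigma> j))"

definition colored_perm_group :: "nat \<Rightarrow> nat \<Rightarrow> ((nat \<Rightarrow> int) \<times> (nat \<Rightarrow> nat)) monoid" where
  "colored_perm_group m n =
     \<lparr>carrier = carrier (color_group m n) \<times> carrier (sym_group n),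
      monoid.mult = (\<lambda>(a, \<sigma>) (b, \<tau>).
        (a \<otimes>\<^bsub>color_group m n\<^esub> perm_act n \<sigma> b, \<sigma> \<otimes>\<^bsub>sym_group n\<^esub> \<tau>)),
      one = (\<one>\<^bsub>color_group m n\<^esub>, \<one>\<^bsub>sym_group n\<^esub>)\<rparr>"

definition prefix_reversal :: "nat \<Rightarrow> nat \<Rightarrow> nat" where
  "prefix_reversal i = (\<lambda>j. if 1 \<le> j \<and> j \<le> i then i + 1 - j else j)"

definition color_shift :: "nat \<Rightarrow> nat \<Rightarrow> nat \<Rightarrow> int \<Rightarrow> nat \<Rightarrow> int" where
  "color_shift m n i \<epsilon> = (\<lambda>j\<in>{1..n}. if j \<le> i then \<epsilon> mod int m else 0)"

definition generalized_prefix_reversals :: "nat \<Rightarrow> nat \<Rightarrow> ((nat \<Rightarrow> int) \<times> (nat \<Rightarrow> nat)) set" where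
  "generalized_prefix_reversals m n =
     {(color_shift m n i \<epsilon>, prefix_reversal i) | i \<epsilon>. i \<in> {1..n} \<and> \<epsilon> \<in> {1, -1}}"

definition pancake_graph :: "nat \<Rightarrow> nat \<Rightarrow> ((nat \<Rightarrow> int) \<times> (nat \<Rightarrow> nat)) graph" where
  "pancake_graph m n =
     cayley_graph (colored_perm_group m n) (generalized_prefix_reversals m n)"

definition gap_const :: "nat \<Rightarrow> real" where
  "gap_const m =
     (if odd m then 1 - cos (pi / real m) else min (1 - cos (2 * pi / real m)) (2 - sqrt 2))"

end

theory Submission
  imports Defs
begin

text \<open>Read a colored permutation \<open>(a, \<sigma>)\<close> as a stack of \<open>n\<close> pancakes: position \<open>j\<close> holds the pancake
with label \<open>\<sigma>\<^sup>-\<^sup>1 j\<close>, showing color \<open>a j\<close>. Left multiplication by \<open>r\<^sub>i\<^sup>\<epsilon>\<close> turns over the top \<open>i\<close>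
pancakes and adds \<open>\<epsilon>\<close> to their colors. Write \<open>D\<^sub>i f\<close> for \<open>f\<close> minus the mean of its two
translates by \<open>r\<^sub>i\<^sup>+\<close> and \<open>r\<^sub>i\<^sup>-\<close>, and \<open>L\<^sub>k = D\<^sub>1 + \<dots> + D\<^sub>k\<close>. The normalized Laplacian of the
pancake graph is \<open>L\<^sub>n / n\<close>, also for \<open>m = 2\<close>, where the two signs coincide. So the claim is that
\<open>L\<^sub>n\<close> has spectral gap between \<open>\<alpha> = \<alpha>\<^sub>m\<close> and \<open>1\<close>.

Lower bound. Call two stacks \<open>k\<close>-equivalent if they agree below position \<open>k\<close>; these classes are
the orbits of a copy of \<open>S(m,k)\<close>. Let \<open>S\<^sub>k f\<close> be the function of class sums of \<open>f\<close>. By induction on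
\<open>k\<close>, \<open>L\<^sub>k + \<alpha> S\<^sub>k \<ge> \<alpha>\<close> as quadratic forms (\<open>form_bound\<close>); for \<open>k = n\<close> and \<open>f\<close> of sum zero this is
the Poincare inequality with constant \<open>\<alpha>\<close>. By the spectral theorem it is enough to look at an
eigenfunction \<open>f\<close>, with eigenvalue \<open>\<mu>\<close>, of the form at level \<open>k\<close>. There are three cases.

  \<^item> If \<open>S\<^sub>k f \<noteq> 0\<close>, then \<open>\<mu>\<close> is \<open>\<alpha>\<close> times the size of a class, because \<open>S\<^sub>k L\<^sub>k = 0\<close>.
  \<^item> If \<open>S\<^sub>k f = 0\<close> and \<open>S\<^bsub>k-1\<^esub> f = 0\<close>, the induction hypothesis applies, since \<open>L\<^sub>k - L\<^bsub>k-1\<^esub> = D\<^sub>k \<ge> 0\<close>.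
  \<^item> If \<open>S\<^sub>k f = 0\<close> but \<open>S\<^bsub>k-1\<^esub> f \<noteq> 0\<close>, follow one pancake \<open>p\<close> through the class, i.e. sum \<open>f\<close> over the
    stacks in which \<open>p\<close> has a given position and color, and take the Fourier transform in the
    color. For some frequency \<open>c\<close> this gives a nonzero function \<open>h\<close> of the position
    alone, which is an eigenfunction, still for \<open>\<mu>\<close>, of the explicit \<open>k \<times> k\<close> matrix of
    \<open>\<Sum>\<^bsub>j+l \<le> k+1\<^esub> ((h\<^sub>j\<^sup>2 + h\<^sub>l\<^sup>2) / 2 - cos (2 \<pi> c / m) h\<^sub>j h\<^sub>l)\<close>, with \<open>\<Sum> h\<^sub>j = 0\<close> if \<open>c = 0\<close>.

This last form is bounded below by \<open>1\<close> if \<open>c = 0\<close>, by \<open>2 - \<surd>2\<close> if the cosine \<open>C\<close> is \<open>-1\<close>,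
and by \<open>1 - \<bar>C\<bar>\<close> in general; the constant \<open>\<alpha>\<^sub>m\<close> is at most the bound that fits \<open>c\<close>.

Upper bound. Fix a label \<open>p\<close> and a color \<open>q\<close>, and let \<open>f\<close> be \<open>1\<close> on the stacks whose bottom pancake
is \<open>p\<close> in color \<open>q\<close>, \<open>-1\<close> on those whose bottom pancake is \<open>p\<close> in color \<open>q + 1\<close>, and \<open>0\<close> elsewhere. Only
the flip of the whole stack changes \<open>f\<close>, and it moves the support of \<open>f\<close> off itself, so \<open>f\<close> has
Rayleigh quotient \<open>1\<close> for \<open>L\<^sub>n\<close>.\<close>

section \<open>Orthogonal diagonalization of real symmetric matrices\<close>
lemma mult_mat_vec_index_sum:
  assumes "A \<in> carrier_mat n n" "v \<in> carrier_vec n" "i < n"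
  shows "(A *\<^sub>v v) $ i = (\<Sum>j<n. A $$ (i,j) * v $ j)"
  using assms by (auto simp: scalar_prod_def lessThan_atLeast0 intro!: sum.cong)

text \<open>The characteristic polynomial has a complex root; that root is real by
the usual Hermitian argument, and so the real or the imaginary part of a complex
eigenvector is a real eigenvector.\<close>
lemma real_symmetric_has_eigenvector:
  fixes A :: "real mat"
  assumes A: "A \<in> carrier_mat n n" and sym: "transpose_mat A = A" and n: "n > 0"
  obtains v e where "eigenvector A v e"
proof -
  have symA: "A $$ (i,j) = A $$ (j,i)" if "i < n" "j < n" for i j
    using that A sym by (metis carrier_matD index_transpose_mat(1))
  define B where "B = map_mat complex_of_real A"
  have B: "B \<in> carrier_mat n n" using A by (simp add: B_def)
  obtain as where as: "char_poly B = (\<Prod>a\<leftarrow>as. [:- a, 1:])" "length as = n"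
    using char_poly_factorized[OF B] by blast
  then obtain e where "poly (char_poly B) e = 0"
    using n by (cases as) auto
  then obtain v where "eigenvector B v e"
    using eigenvalue_root_char_poly[OF B] by (auto simp: eigenvalue_def)
  then have v: "v \<in> carrier_vec n" "v \<noteq> 0\<^sub>v n" "B *\<^sub>v v = e \<cdot>\<^sub>v v"
    using B by (auto simp: eigenvector_def)
  have ev: "(\<Sum>j<n. complex_of_real (A $$ (i,j)) * v $ j) = e * v $ i" if "i < n" for i
  proof -
    have "(B *\<^sub>v v) $ i = (\<Sum>j<n. complex_of_real (A $$ (i,j)) * v $ j)"
      using mult_mat_vec_index_sum[OF B v(1) that] A that by (simp add: B_def)
    then show ?thesis using v that by simp
  qed
  \<comment> \<open>\<open>v\<^sup>* A v\<close> equals its own conjugate because \<open>A\<close> is real and symmetric, so \<open>e\<close> is real.\<close>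
  define q where "q = (\<Sum>i<n. \<Sum>j<n. cnj (v $ i) * complex_of_real (A $$ (i,j)) * v $ j)"
  define N where "N = (\<Sum>i<n. (cmod (v $ i))\<^sup>2)"
  have "q = (\<Sum>i<n. cnj (v $ i) * (e * v $ i))"
    unfolding q_def by (rule sum.cong) (auto simp: ev[symmetric] sum_distrib_left mult.assoc)
  also have "\<dots> = e * complex_of_real N"
    unfolding N_def of_real_sum complex_norm_square by (simp add: sum_distrib_left mult_ac)
  finally have q1: "q = e * complex_of_real N" .
  have "cnj q = (\<Sum>i<n. \<Sum>j<n. cnj (v $ j) * complex_of_real (A $$ (j,i)) * v $ i)"
    unfolding q_def by (auto simp: symA mult_ac intro!: sum.cong)
  also have "\<dots> = q" unfolding q_def by (subst sum.swap) simp
  finally have q2: "cnj q = q" .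
  obtain k where k: "k < n" "v $ k \<noteq> 0"
    using v by (metis carrier_vecD eq_vecI index_zero_vec(1) index_zero_vec(2))
  have "0 < (cmod (v $ k))\<^sup>2" using k by simp
  also have "\<dots> \<le> N" unfolding N_def by (rule member_le_sum) (use k in auto)
  finally have "N > 0" .
  with q1 q2 have "cnj e = e" by auto
  then have e: "e = complex_of_real (Re e)" by (simp add: complex_eq_iff)
  have evp: "eigenvector A (vec n (\<lambda>i. g (v $ i))) (Re e)"
    if g: "g = Re \<or> g = Im" and nz: "g (v $ k) \<noteq> 0" for g :: "complex \<Rightarrow> real"
  proof -
    have lin: "g (\<Sum>j<n. complex_of_real (a j) * z j) = (\<Sum>j<n. a j * g (z j))" for a z
      using g by auto
    have mul: "g (e * z) = Re e * g z" for z
      using g by (subst e) auto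
    have "A *\<^sub>v vec n (\<lambda>i. g (v $ i)) = Re e \<cdot>\<^sub>v vec n (\<lambda>i. g (v $ i))"
    proof (rule eq_vecI)
      fix i assume "i < dim_vec (Re e \<cdot>\<^sub>v vec n (\<lambda>i. g (v $ i)))"
      then have i: "i < n" by simp
      have "(A *\<^sub>v vec n (\<lambda>i. g (v $ i))) $ i = (\<Sum>j<n. A $$ (i,j) * g (v $ j))"
        using mult_mat_vec_index_sum[OF A _ i, of "vec n (\<lambda>i. g (v $ i))"] by simp
      also have "\<dots> = g (\<Sum>j<n. complex_of_real (A $$ (i,j)) * v $ j)" by (rule lin[symmetric])
      also have "\<dots> = Re e * g (v $ i)" by (simp add: ev[OF i] mul)
      finally show "(A *\<^sub>v vec n (\<lambda>i. g (v $ i))) $ i = (Re e \<cdot>\<^sub>v vec n (\<lambda>i. g (v $ i))) $ i"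
        using i by simp
    qed (use A in auto)
    moreover have "vec n (\<lambda>i. g (v $ i)) \<noteq> 0\<^sub>v n"
      using nz k by (metis index_vec index_zero_vec(1))
    ultimately show ?thesis using A by (auto simp: eigenvector_def)
  qed
  have "Re (v $ k) \<noteq> 0 \<or> Im (v $ k) \<noteq> 0" using k by (simp add: complex_eq_iff)
  then show ?thesis using that evp[of Re] evp[of Im] by blast
qed

text \<open>The Householder reflection in the hyperplane orthogonal to \<open>w = v - e\<^sub>0\<close> exchanges the unit
vectors \<open>v\<close> and \<open>e\<^sub>0\<close>. With it an orthogonal matrix with a prescribed first column is
obtained without Gram-Schmidt, and it is even symmetric.\<close>
lemma orthogonal_mat_with_first_column:
  fixes v :: "real vec"
  assumes v: "v \<in> carrier_vec n" and unit: "v \<bullet> v = 1" and n: "n > 0"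
  obtains H where "H \<in> carrier_mat n n" "transpose_mat H = H" "H * H = 1\<^sub>m n" "col H 0 = v"
proof -
  define w where "w i = v $ i - (if i = 0 then 1 else 0)" for i
  \<comment> \<open>The reflection is \<open>1 - 2 w w\<^sup>T / (w \<bullet> w)\<close>, and \<open>w \<bullet> w = 2 (1 - v\<^sub>0)\<close>.\<close>
  define c where "c = (if v $ 0 = 1 then 0 else 1 / (1 - v $ 0))"
  define H where "H = mat n n (\<lambda>(i,j). (if i = j then 1 else 0) - c * w i * w j)"
  have H: "H \<in> carrier_mat n n" by (simp add: H_def)
  have vv: "(\<Sum>i<n. v $ i * v $ i) = 1"
    using unit v by (simp add: scalar_prod_def lessThan_atLeast0)
  have "(\<Sum>i<n. w i * w i)
      = (\<Sum>i<n. v $ i * v $ i) - (\<Sum>i<n. if i = 0 then 2 * v $ i - 1 else 0)"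
    unfolding sum_subtractf[symmetric] by (rule sum.cong) (auto simp: w_def algebra_simps)
  then have ww: "(\<Sum>i<n. w i * w i) = 2 - 2 * v $ 0"
    using n vv by (simp add: sum.delta)
  have cw: "c * (c * (\<Sum>i<n. w i * w i)) = 2 * c"
  proof (cases "v $ 0 = 1")
    case False
    then have "c * (1 - v $ 0) = 1" by (simp add: c_def)
    then have "2 * c * (c * (1 - v $ 0)) = 2 * c" by simp
    then show ?thesis unfolding ww by (simp add: algebra_simps)
  qed (simp add: c_def)
  have "transpose_mat H = H"
    by (rule eq_matI) (auto simp: H_def mult_ac)
  moreover have "H * H = 1\<^sub>m n"
  proof (rule eq_matI)
    fix i j assume "i < dim_row (1\<^sub>m n :: real mat)" "j < dim_col (1\<^sub>m n :: real mat)"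
    then have ij: "i < n" "j < n" by auto
    have "(H * H) $$ (i,j) = (\<Sum>k<n. H $$ (i,k) * H $$ (k,j))"
      using H ij by (auto simp: scalar_prod_def lessThan_atLeast0 intro!: sum.cong)
    also have "\<dots> = (\<Sum>k<n. (if k = i then (if i = j then 1 else 0) - c * w i * w j else 0)
        - (if k = j then c * w i * w j else 0) + (c * c * w i * w j) * (w k * w k))"
      by (rule sum.cong) (auto simp: H_def ij algebra_simps)
    also have "\<dots> = (if i = j then 1 else 0) - 2 * c * w i * w j
         + (c * c * w i * w j) * (\<Sum>k<n. w k * w k)"
      unfolding sum.distrib sum_subtractf sum_distrib_left[symmetric] using ij
      by (simp add: sum.delta)
    also have "(c * c * w i * w j) * (\<Sum>k<n. w k * w k) = c * (c * (\<Sum>i<n. w i * w i)) * (w i * w j)"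
      by (simp add: mult_ac)
    also have "\<dots> = 2 * c * (w i * w j)" unfolding cw by simp
    finally show "(H * H) $$ (i,j) = 1\<^sub>m n $$ (i,j)" using ij by simp
  qed (use H in auto)
  moreover have "col H 0 = v"
  proof (rule eq_vecI)
    fix i assume "i < dim_vec v"
    then have i: "i < n" using v by simp
    show "col H 0 $ i = v $ i"
    proof (cases "v $ 0 = 1")
      case True
      then have w0: "w i * w i = 0" 
        using sum_nonneg_eq_0_iff[of "{..<n}" "\<lambda>i. w i * w i"] ww i by simp
      then show ?thesis using i n True by (auto simp: H_def w_def c_def split: if_splits)
    next
      case False
      then have "c * w 0 = - 1" by (simp add: c_def w_def field_simps)
      then have "c * w i * w 0 = - w i" by (metis mult.assoc mult.commute mult_minus1_right)
      then show ?thesis using i n by (simp add: H_def w_def)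
    qed
  qed (use v H in auto)
  ultimately show ?thesis using that H by blast
qed

text \<open>Induction on the size: conjugating with the reflection that takes \<open>e\<^sub>0\<close> to a unit eigenvector
splits off a \<open>1 \<times> 1\<close> block, because symmetry clears the first row along with the first column.\<close>
lemma real_spectral_theorem:
  fixes A :: "real mat"
  assumes "A \<in> carrier_mat n n" "transpose_mat A = A"
  shows "\<exists>P d. P \<in> carrier_mat n n \<and> transpose_mat P * P = 1\<^sub>m n \<and> P * transpose_mat P = 1\<^sub>m n
           \<and> A = P * mat_diag n d * transpose_mat P"
  using assms
proof (induction n arbitrary: A)
  case 0
  then show ?case by (intro exI[of _ "1\<^sub>m 0"] exI[of _ "\<lambda>_. 0"]) auto
next
  case (Suc n)
  note A = Suc.prems(1)
  obtain v0 e where v0: "eigenvector A v0 e"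
    using real_symmetric_has_eigenvector[OF Suc.prems] by blast
  define r where "r = 1 / sqrt (v0 \<bullet> v0)"
  define v where "v = r \<cdot>\<^sub>v v0"
  have v0c: "v0 \<in> carrier_vec (Suc n)" "v0 \<noteq> 0\<^sub>v (Suc n)" "A *\<^sub>v v0 = e \<cdot>\<^sub>v v0"
    using v0 A by (auto simp: eigenvector_def)
  have "v0 \<bullet> v0 > 0"
    using v0c conjugate_square_greater_0_vec[of v0 "Suc n"] by simp
  then have "r * (r * (v0 \<bullet> v0)) = 1"
    by (simp add: r_def field_simps)
  then have vv: "v \<bullet> v = 1" using v0c(1) by (simp add: v_def)
  have v: "v \<in> carrier_vec (Suc n)" "A *\<^sub>v v = e \<cdot>\<^sub>v v"
    using v0c A by (auto simp: v_def mult_mat_vec smult_smult_assoc mult.commute)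
  obtain H where H: "H \<in> carrier_mat (Suc n) (Suc n)" "transpose_mat H = H"
      "H * H = 1\<^sub>m (Suc n)" "col H 0 = v"
    using orthogonal_mat_with_first_column[OF v(1) vv] by blast
  define M where "M = H * A * H"
  have M: "M \<in> carrier_mat (Suc n) (Suc n)" using H A by (simp add: M_def)
  have symM: "transpose_mat M = M"
    unfolding M_def using H A Suc.prems(2)
    by (simp add: transpose_mult[of _ "Suc n" "Suc n" _ "Suc n"] assoc_mult_mat[of _ "Suc n" "Suc n" _ "Suc n" _ "Suc n"])
  have "col M 0 = (H * A) *\<^sub>v v" unfolding M_def using H A by (subst col_mult2) auto
  also have "\<dots> = H *\<^sub>v (A *\<^sub>v v)" using H A v by (simp add: assoc_mult_mat_vec)
  also have "\<dots> = e \<cdot>\<^sub>v (H *\<^sub>v col H 0)" using H v by (simp add: mult_mat_vec)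
  also have "H *\<^sub>v col H 0 = col (1\<^sub>m (Suc n)) 0" using H(1,3) by (metis col_mult2 zero_less_Suc)
  finally have colM: "col M 0 = e \<cdot>\<^sub>v unit_vec (Suc n) 0" by simp
  have M0: "M $$ (i,0) = (if i = 0 then e else 0)" if "i < Suc n" for i
    using that arg_cong[OF colM, of "\<lambda>w. w $ i"] M by simp
  have M0': "M $$ (0,i) = (if i = 0 then e else 0)" if "i < Suc n" for i
    using M0[OF that] that M symM by (metis carrier_matD index_transpose_mat(1) zero_less_Suc)
  define B where "B = mat n n (\<lambda>(i,j). M $$ (Suc i, Suc j))"
  have B: "B \<in> carrier_mat n n" by (simp add: B_def)
  have "transpose_mat B = B"
  proof (rule eq_matI)
    fix i j assume "i < dim_row B" "j < dim_col B"
    then show "transpose_mat B $$ (i,j) = B $$ (i,j)"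
      using arg_cong[OF symM, of "\<lambda>N. N $$ (Suc i, Suc j)"] M by (simp add: B_def)
  qed (auto simp: B_def)
  from Suc.IH[OF B this] obtain P d where P: "P \<in> carrier_mat n n" "transpose_mat P * P = 1\<^sub>m n"
      "P * transpose_mat P = 1\<^sub>m n" "B = P * mat_diag n d * transpose_mat P" by blast
  define E where "E = mat_diag 1 (\<lambda>_. e)"
  define d' where "d' = (\<lambda>i. case i of 0 \<Rightarrow> e | Suc k \<Rightarrow> d k)"
  define F where "F C D = four_block_mat C (0\<^sub>m 1 n) (0\<^sub>m n 1) D" for C D :: "real mat"
  have F_mult: "F C D * F C' D' = F (C * C') (D * D')"
    if "C \<in> carrier_mat 1 1" "D \<in> carrier_mat n n" "C' \<in> carrier_mat 1 1" "D' \<in> carrier_mat n n"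
    for C D C' D'
    unfolding F_def using that by (subst mult_four_block_mat[of _ 1 1 _ n _ n _ _ 1 _ n]) auto
  have F_car: "F C D \<in> carrier_mat (Suc n) (Suc n)"
    if "C \<in> carrier_mat 1 1" "D \<in> carrier_mat n n" for C D
    using four_block_carrier_mat[OF that] by (simp add: F_def)
  have F_tr: "transpose_mat (F C D) = F (transpose_mat C) (transpose_mat D)"
    if "C \<in> carrier_mat 1 1" "D \<in> carrier_mat n n" for C D
    unfolding F_def using that by (subst transpose_four_block_mat[of _ 1 1 _ n _ n]) (auto simp: zero_transpose_mat)
  have F_one: "F (1\<^sub>m 1) (1\<^sub>m n) = 1\<^sub>m (Suc n)"
    unfolding F_def by simp
  have "M = F E B"
    by (rule eq_matI) (use M in \<open>auto simp: F_def E_def B_def mat_diag_def M0 M0'\<close>)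
  have Dd: "F E (mat_diag n d) = mat_diag (Suc n) d'"
    by (rule eq_matI) (auto simp: F_def E_def mat_diag_def d'_def split: nat.splits)
  define U where "U = F (1\<^sub>m 1) P"
  have E: "E \<in> carrier_mat 1 1" by (simp add: E_def)
  have U: "U \<in> carrier_mat (Suc n) (Suc n)" "transpose_mat U = F (1\<^sub>m 1) (transpose_mat P)"
    using F_car F_tr P by (auto simp: U_def)
  have UU: "transpose_mat U * U = 1\<^sub>m (Suc n)" "U * transpose_mat U = 1\<^sub>m (Suc n)"
    unfolding U(2) unfolding U_def using P F_one by (simp_all add: F_mult)
  have MU: "M = U * mat_diag (Suc n) d' * transpose_mat U"
    unfolding U(2) unfolding U_def Dd[symmetric] \<open>M = F E B\<close> using P E by (simp add: F_mult)
  define Q where "Q = H * U"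
  have Ut: "transpose_mat U \<in> carrier_mat (Suc n) (Suc n)" using U(1) by simp
  have Q: "Q \<in> carrier_mat (Suc n) (Suc n)" "transpose_mat Q = transpose_mat U * H"
    using H U by (auto simp: Q_def transpose_mult[of _ "Suc n" "Suc n"])
  note assoc = assoc_mult_mat[of _ "Suc n" "Suc n" _ "Suc n" _ "Suc n"]
  have cancel: "H * (H * Z) = Z" if "Z \<in> carrier_mat (Suc n) (Suc n)" for Z
    using that H by (simp add: assoc[symmetric])
  have cancel1: "transpose_mat U * (U * Z) = Z" "U * (transpose_mat U * Z) = Z"
    if "Z \<in> carrier_mat (Suc n) (Suc n)" for Z
    using that U(1) UU Ut by (simp_all add: assoc[symmetric])
  have "transpose_mat Q * Q = 1\<^sub>m (Suc n)"
    unfolding Q(2) unfolding Q_def using H(1) U(1) UU Ut by (simp add: assoc cancel)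
  moreover have "Q * transpose_mat Q = 1\<^sub>m (Suc n)"
    unfolding Q(2) unfolding Q_def using H(1,3) U(1) UU Ut by (simp add: assoc cancel1)
  moreover have "Q * mat_diag (Suc n) d' * transpose_mat Q = A"
  proof -
    have "Q * mat_diag (Suc n) d' * transpose_mat Q = H * M * H"
      unfolding Q(2) MU unfolding Q_def using H(1) U(1) Ut
      by (simp add: assoc mult_carrier_mat[of _ "Suc n" "Suc n" _ "Suc n"])
    also have "\<dots> = A" unfolding M_def using H(1,3) A by (simp add: assoc cancel)
    finally show ?thesis .
  qed
  ultimately show ?case using Q(1) by metis
qed

section \<open>The second smallest eigenvalue\<close>
lemma eigenvalue_list_eq_sort:
  assumes "char_poly A = (\<Prod>k<n. [:- d k, 1:])"
  shows "eigenvalue_list A = sort (map d [0..<n])"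
proof -
  have "proots (char_poly A) = mset (map d [0..<n])"
  proof -
    have "proots (\<Prod>k<n. [:- d k, 1:]) = mset (map d [0..<n])"
    proof (induction n)
      case (Suc n)
      have "(\<Prod>k<n. [:- d k, 1:]) \<noteq> 0" by (simp add: prod_zero_iff)
      with Suc show ?case by (simp add: proots_mult del: mult_pCons_right)
    qed simp
    then show ?thesis by (simp add: assms)
  qed
  then show ?thesis
    by (simp only: eigenvalue_list_def sorted_list_of_multiset_mset)
qed

lemma card_filter_sort:
  fixes d :: "nat \<Rightarrow> real"
  shows "card {i. i < n \<and> P (sort (map d [0..<n]) ! i)} = card {i. i < n \<and> P (d i)}"
proof -
  have "length (filter P (sort (map d [0..<n]))) = length (filter P (map d [0..<n]))"
    by (simp add: filter_sort)
  then show ?thesis by (simp add: length_filter_conv_card cong: conj_cong)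
qed

text \<open>These two lemmas reduce the second entry of the sorted list to statements about two indices of the
unsorted family; repeated eigenvalues need no special treatment.\<close>
lemma second_smallest_ge:
  fixes d :: "nat \<Rightarrow> real"
  assumes n: "2 \<le> n" and two: "\<And>i j. i < n \<Longrightarrow> j < n \<Longrightarrow> i \<noteq> j \<Longrightarrow> c \<le> d i \<or> c \<le> d j"
  shows "c \<le> sort (map d [0..<n]) ! 1"
proof (rule ccontr)
  let ?s = "sort (map d [0..<n])"
  assume "\<not> c \<le> ?s ! 1"
  moreover have "?s ! 0 \<le> ?s ! 1" using n by (intro sorted_nth_mono) auto
  ultimately have "{0,1} \<subseteq> {i. i < n \<and> ?s ! i < c}" using n by auto
  from card_mono[OF _ this] have "2 \<le> card {i. i < n \<and> d i < c}"
    using card_filter_sort[of n "\<lambda>x. x < c" d] by simp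
  then obtain i j where "i \<in> {i. i < n \<and> d i < c}" "j \<in> {i. i < n \<and> d i < c}" "i \<noteq> j"
    by (meson card_2_iff' obtain_subset_with_card_n subsetD)
  with two show False by force
qed

lemma second_smallest_le:
  fixes d :: "nat \<Rightarrow> real"
  assumes ij: "i < n" "j < n" "i \<noteq> j" "d i \<le> c" "d j \<le> c"
  shows "sort (map d [0..<n]) ! 1 \<le> c"
proof (rule ccontr)
  let ?s = "sort (map d [0..<n])"
  assume *: "\<not> ?s ! 1 \<le> c"
  have "k = 0" if "k < n" "?s ! k \<le> c" for k
  proof (rule ccontr)
    assume "k \<noteq> 0"
    with that have "?s ! 1 \<le> ?s ! k" by (intro sorted_nth_mono) auto
    with that * show False by simp
  qed
  then have "{i. i < n \<and> ?s ! i \<le> c} \<subseteq> {0}" by blast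
  from card_mono[OF _ this] have "card {i. i < n \<and> d i \<le> c} \<le> 1"
    using card_filter_sort[of n "\<lambda>x. x \<le> c" d] by simp
  moreover have "{i,j} \<subseteq> {i. i < n \<and> d i \<le> c}" using ij by auto
  from card_mono[OF _ this] have "2 \<le> card {i. i < n \<and> d i \<le> c}" using ij by simp
  ultimately show False by simp
qed

text \<open>From here on matrices act on functions on a finite set, so that group elements
can serve as indices.\<close>
definition kernel_form :: "'a set \<Rightarrow> ('a \<Rightarrow> 'a \<Rightarrow> real) \<Rightarrow> ('a \<Rightarrow> real) \<Rightarrow> real" where
  "kernel_form X K f = (\<Sum>x\<in>X. f x * (\<Sum>y\<in>X. K x y * f y))"

definition kernel_matrix :: "'a list \<Rightarrow> ('a \<Rightarrow> 'a \<Rightarrow> real) \<Rightarrow> real mat" where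
  "kernel_matrix xs K = mat (length xs) (length xs) (\<lambda>(i,j). K (xs ! i) (xs ! j))"

text \<open>The two expansions in squared coefficients say that the family is complete, and the last
clause ties the eigenvalues \<open>d\<close>, with multiplicity, to the characteristic polynomial.\<close>
definition orthonormal_eigenbasis ::
  "'a list \<Rightarrow> ('a \<Rightarrow> 'a \<Rightarrow> real) \<Rightarrow> (nat \<Rightarrow> 'a \<Rightarrow> real) \<Rightarrow> (nat \<Rightarrow> real) \<Rightarrow> bool" where
  "orthonormal_eigenbasis xs K u d \<longleftrightarrow>
    (\<forall>k<length xs. \<forall>x\<in>set xs. (\<Sum>y\<in>set xs. K x y * u k y) = d k * u k x) \<and>
    (\<forall>k<length xs. \<forall>l<length xs. (\<Sum>x\<in>set xs. u k x * u l x) = (if k = l then 1 else 0)) \<and>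
    (\<forall>f. (\<Sum>x\<in>set xs. (f x)\<^sup>2) = (\<Sum>k<length xs. (\<Sum>x\<in>set xs. u k x * f x)\<^sup>2)) \<and>
    (\<forall>f. kernel_form (set xs) K f = (\<Sum>k<length xs. d k * (\<Sum>x\<in>set xs. u k x * f x)\<^sup>2)) \<and>
    char_poly (kernel_matrix xs K) = (\<Prod>k<length xs. [:- d k, 1:])"

lemma kernel_eigenbasis:
  fixes K :: "'a \<Rightarrow> 'a \<Rightarrow> real"
  assumes dist: "distinct xs"
      and sym: "\<And>x y. x \<in> set xs \<Longrightarrow> y \<in> set xs \<Longrightarrow> K x y = K y x"
  shows "\<exists>u d. orthonormal_eigenbasis xs K u d"
proof -
  define n where "n = length xs"
  define A where "A = kernel_matrix xs K"
  have A: "A \<in> carrier_mat n n" by (simp add: A_def n_def kernel_matrix_def)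
  have "transpose_mat A = A"
    by (rule eq_matI) (auto simp: A_def kernel_matrix_def sym)
  from real_spectral_theorem[OF A this] obtain P d where
    P: "P \<in> carrier_mat n n" "transpose_mat P * P = 1\<^sub>m n" "P * transpose_mat P = 1\<^sub>m n"
       "A = P * mat_diag n d * transpose_mat P" by blast
  have "similar_mat_wit A (mat_diag n d) P (transpose_mat P)"
    using A P by (simp add: similar_mat_wit_def Let_def)
  then have "char_poly A = char_poly (mat_diag n d)"
    by (intro char_poly_similar) (auto simp: similar_mat_def)
  also have "\<dots> = (\<Prod>a\<leftarrow>diag_mat (mat_diag n d). [:- a, 1:])"
    by (rule char_poly_upper_triangular[of _ n]) (auto simp: mat_diag_def)
  also have "diag_mat (mat_diag n d) = map d [0..<n]"
    by (auto simp: diag_mat_def mat_diag_def)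
  also have "(\<Prod>a\<leftarrow>map d [0..<n]. [:- a, 1:]) = (\<Prod>k<n. [:- d k, 1:])"
    using prod.distinct_set_conv_list[of "[0..<n]" "\<lambda>k. [:- d k, 1:]"]
    by (simp add: lessThan_atLeast0 o_def)
  finally have cp: "char_poly A = (\<Prod>k<n. [:- d k, 1:])" .
  have bij: "bij_betw (\<lambda>i. xs ! i) {..<n} (set xs)"
    using dist by (auto simp: n_def intro!: bij_betw_nth)
  define idx where "idx = the_inv_into {..<n} (\<lambda>i. xs ! i)"
  have idx: "idx (xs ! i) = i" if "i < n" for i
    unfolding idx_def using bij that by (intro the_inv_into_f_f) (auto simp: bij_betw_def)
  have S: "(\<Sum>x\<in>set xs. g x) = (\<Sum>i<n. g (xs ! i))" for g :: "'a \<Rightarrow> real"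
    using sum.reindex_bij_betw[OF bij, of g] by simp
  define u where "u k x = P $$ (idx x, k)" for k x
  have u: "u k (xs ! i) = P $$ (i, k)" if "i < n" for i k using idx that by (simp add: u_def)
  have Aij: "K (xs ! i) (xs ! j) = (\<Sum>k<n. d k * u k (xs ! i) * u k (xs ! j))" if ij: "i < n" "j < n" for i j
  proof -
    have "K (xs ! i) (xs ! j) = A $$ (i,j)" using ij by (simp add: A_def kernel_matrix_def n_def)
    also have "\<dots> = (\<Sum>k<n. d k * P $$ (i,k) * P $$ (j,k))"
      unfolding P(4) mat_diag_mult_right[OF P(1)] using P(1) ij
      by (auto simp: scalar_prod_def lessThan_atLeast0 mult_ac intro!: sum.cong)
    finally show ?thesis using ij by (simp add: u)
  qed
  have K: "K x y = (\<Sum>k<n. d k * u k x * u k y)" if "x \<in> set xs" "y \<in> set xs" for x y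
    using that Aij by (auto simp: in_set_conv_nth n_def)
  have orth: "(\<Sum>x\<in>set xs. u k x * u l x) = (if k = l then 1 else 0)" if kl: "k < n" "l < n" for k l
  proof -
    have "(\<Sum>x\<in>set xs. u k x * u l x) = (transpose_mat P * P) $$ (k,l)"
      unfolding S using P(1) kl by (auto simp: u scalar_prod_def lessThan_atLeast0 intro!: sum.cong)
    then show ?thesis unfolding P(2) using kl by simp
  qed
  have comp: "(\<Sum>k<n. u k x * u k y) = (if x = y then 1 else 0)" if xy: "x \<in> set xs" "y \<in> set xs" for x y
  proof -
    obtain i j where ij: "i < n" "j < n" "x = xs ! i" "y = xs ! j"
      using xy by (auto simp: in_set_conv_nth n_def)
    have "(\<Sum>k<n. u k x * u k y) = (P * transpose_mat P) $$ (i,j)"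
      using P(1) ij by (auto simp: u scalar_prod_def lessThan_atLeast0 intro!: sum.cong)
    then show ?thesis unfolding P(3) using ij dist by (simp add: nth_eq_iff_index_eq n_def)
  qed
  have form: "(\<Sum>x\<in>set xs. \<Sum>y\<in>set xs. f x * (\<Sum>k<n. c k * u k x * u k y) * f y)
      = (\<Sum>k<n. c k * (\<Sum>x\<in>set xs. u k x * f x)\<^sup>2)" for f c
  proof -
    have "(\<Sum>x\<in>set xs. \<Sum>y\<in>set xs. f x * (\<Sum>k<n. c k * u k x * u k y) * f y)
        = (\<Sum>x\<in>set xs. \<Sum>y\<in>set xs. \<Sum>k<n. c k * ((u k x * f x) * (u k y * f y)))"
      by (simp add: sum_distrib_left sum_distrib_right mult_ac)
    also have "\<dots> = (\<Sum>x\<in>set xs. \<Sum>k<n. \<Sum>y\<in>set xs. c k * ((u k x * f x) * (u k y * f y)))"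
      by (intro sum.cong refl sum.swap)
    also have "\<dots> = (\<Sum>k<n. \<Sum>x\<in>set xs. \<Sum>y\<in>set xs. c k * ((u k x * f x) * (u k y * f y)))"
      by (rule sum.swap)
    also have "\<dots> = (\<Sum>k<n. c k * (\<Sum>x\<in>set xs. u k x * f x)\<^sup>2)"
      by (simp only: power2_eq_square sum_product) (simp only: sum_distrib_left)
    finally show ?thesis .
  qed
  have "kernel_form (set xs) K f = (\<Sum>k<n. d k * (\<Sum>x\<in>set xs. u k x * f x)\<^sup>2)" for f
    unfolding form[symmetric] kernel_form_def
    by (auto simp: K sum_distrib_left mult_ac intro!: sum.cong)
  moreover have "(\<Sum>x\<in>set xs. (f x)\<^sup>2) = (\<Sum>k<n. (\<Sum>x\<in>set xs. u k x * f x)\<^sup>2)" for f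
  proof -
    have "(\<Sum>k<n. 1 * (\<Sum>x\<in>set xs. u k x * f x)\<^sup>2)
        = (\<Sum>x\<in>set xs. \<Sum>y\<in>set xs. f x * (\<Sum>k<n. 1 * u k x * u k y) * f y)"
      by (rule form[symmetric])
    also have "\<dots> = (\<Sum>x\<in>set xs. \<Sum>y\<in>set xs. if x = y then f x * f y else 0)"
      by (intro sum.cong refl) (simp add: comp)
    also have "\<dots> = (\<Sum>x\<in>set xs. (f x)\<^sup>2)"
      by (simp add: power2_eq_square)
    finally show ?thesis by simp
  qed
  moreover have "(\<Sum>y\<in>set xs. K x y * u k y) = d k * u k x" if kx: "k < n" "x \<in> set xs" for k x
  proof -
    have "(\<Sum>y\<in>set xs. K x y * u k y) = (\<Sum>y\<in>set xs. \<Sum>l<n. d l * u l x * (u l y * u k y))"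
      using kx by (auto simp: K sum_distrib_right sum_distrib_left mult_ac intro!: sum.cong)
    also have "\<dots> = (\<Sum>l<n. d l * u l x * (\<Sum>y\<in>set xs. u l y * u k y))"
      by (subst sum.swap) (simp add: sum_distrib_left)
    also have "\<dots> = (\<Sum>l<n. if l = k then d l * u l x else 0)"
      by (rule sum.cong) (use kx in \<open>auto simp: orth\<close>)
    finally show ?thesis using kx by simp
  qed
  ultimately have "orthonormal_eigenbasis xs K u d"
    using orth cp by (simp add: orthonormal_eigenbasis_def n_def A_def)
  then show ?thesis by blast
qed

text \<open>Bounding a quadratic form below by looking at eigenfunctions only. In the induction on the
number of flips this allows the induction hypothesis to be a statement about all functions while
the step deals with an eigenfunction.\<close>
lemma kernel_form_ge_least_eigenvalue:
  fixes K :: "'a \<Rightarrow> 'a \<Rightarrow> real"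
  assumes fin: "finite X" and sym: "\<And>x y. x \<in> X \<Longrightarrow> y \<in> X \<Longrightarrow> K x y = K y x"
      and ev: "\<And>f \<mu>. (\<And>x. x \<in> X \<Longrightarrow> (\<Sum>y\<in>X. K x y * f y) = \<mu> * f x) \<Longrightarrow> \<exists>x\<in>X. f x \<noteq> 0 \<Longrightarrow> c \<le> \<mu>"
  shows "c * (\<Sum>x\<in>X. (f x)\<^sup>2) \<le> kernel_form X K f"
proof -
  obtain xs where xs: "distinct xs" "X = set xs" using finite_distinct_list[OF fin] by blast
  have symx: "K x y = K y x" if "x \<in> set xs" "y \<in> set xs" for x y
    using sym that xs(2) by simp
  obtain u d where "orthonormal_eigenbasis xs K u d"
    using kernel_eigenbasis[of xs K] xs(1) symx by blast
  then have u:
    "\<And>k x. k < length xs \<Longrightarrow> x \<in> set xs \<Longrightarrow> (\<Sum>y\<in>set xs. K x y * u k y) = d k * u k x"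
    "\<And>k l. k < length xs \<Longrightarrow> l < length xs \<Longrightarrow>
        (\<Sum>x\<in>set xs. u k x * u l x) = (if k = l then 1 else 0)"
    "\<And>f. (\<Sum>x\<in>set xs. (f x)\<^sup>2) = (\<Sum>k<length xs. (\<Sum>x\<in>set xs. u k x * f x)\<^sup>2)"
    "\<And>f. kernel_form (set xs) K f = (\<Sum>k<length xs. d k * (\<Sum>x\<in>set xs. u k x * f x)\<^sup>2)"
    and cp: "char_poly (kernel_matrix xs K) = (\<Prod>k<length xs. [:- d k, 1:])"
    by (simp_all add: orthonormal_eigenbasis_def)
  have "c \<le> d k" if k: "k < length xs" for k
  proof (rule ev[of "u k"])
    show "\<exists>x\<in>X. u k x \<noteq> 0"
    proof (rule ccontr)
      assume "\<not> ?thesis"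
      then have "(\<Sum>x\<in>set xs. u k x * u k x) = 0" using xs by simp
      with u(2)[OF k k] show False by simp
    qed
  qed (use u(1) k xs in auto)
  then have "c * (\<Sum>k<length xs. (\<Sum>x\<in>set xs. u k x * f x)\<^sup>2) \<le> kernel_form X K f"
    unfolding xs(2) u(4) sum_distrib_left by (intro sum_mono mult_right_mono) auto
  then show ?thesis unfolding xs(2) u(3) .
qed

lemma exists_orthogonal_combination:
  fixes a b :: real
  obtains s t where "s * a + t * b = 0" "s \<noteq> 0 \<or> t \<noteq> 0"
proof (cases "a = 0 \<and> b = 0")
  case True then show ?thesis using that[of 1 0] by simp
next
  case False then show ?thesis using that[of b "- a"] by (auto simp: mult.commute)
qed

text \<open>The Courant-Fischer argument: two eigenvalues below \<open>c\<close> would give a plane on which the form is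
less than \<open>c\<close> times the square norm, and every plane contains a nonzero function of sum zero.\<close>
lemma second_eigenvalue_ge:
  fixes K :: "'a \<Rightarrow> 'a \<Rightarrow> real"
  assumes xs: "distinct xs" "2 \<le> length xs"
      and sym: "\<And>x y. x \<in> set xs \<Longrightarrow> y \<in> set xs \<Longrightarrow> K x y = K y x"
      and form: "\<And>f. (\<Sum>x\<in>set xs. f x) = 0 \<Longrightarrow> c * (\<Sum>x\<in>set xs. (f x)\<^sup>2) \<le> kernel_form (set xs) K f"
  shows "c \<le> eigenvalue_list (kernel_matrix xs K) ! 1"
proof -
  obtain u d where "orthonormal_eigenbasis xs K u d"
    using kernel_eigenbasis[of xs K] xs(1) sym by blast
  then have u:
    "\<And>k x. k < length xs \<Longrightarrow> x \<in> set xs \<Longrightarrow> (\<Sum>y\<in>set xs. K x y * u k y) = d k * u k x"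
    "\<And>k l. k < length xs \<Longrightarrow> l < length xs \<Longrightarrow>
        (\<Sum>x\<in>set xs. u k x * u l x) = (if k = l then 1 else 0)"
    "\<And>f. (\<Sum>x\<in>set xs. (f x)\<^sup>2) = (\<Sum>k<length xs. (\<Sum>x\<in>set xs. u k x * f x)\<^sup>2)"
    "\<And>f. kernel_form (set xs) K f = (\<Sum>k<length xs. d k * (\<Sum>x\<in>set xs. u k x * f x)\<^sup>2)"
    and cp: "char_poly (kernel_matrix xs K) = (\<Prod>k<length xs. [:- d k, 1:])"
    by (simp_all add: orthonormal_eigenbasis_def)
  have "c \<le> d i \<or> c \<le> d j" if ij: "i < length xs" "j < length xs" "i \<noteq> j" for i j
  proof (rule ccontr)
    assume neg: "\<not> ?thesis"
    obtain s t where st: "s * (\<Sum>x\<in>set xs. u i x) + t * (\<Sum>x\<in>set xs. u j x) = 0" "s \<noteq> 0 \<or> t \<noteq> 0"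
      using exists_orthogonal_combination .
    define f where "f x = s * u i x + t * u j x" for x
    have inner: "(\<Sum>x\<in>set xs. f x * (a * u i x + b * u j x)) = s * a + t * b" for a b
    proof -
      have "(\<Sum>x\<in>set xs. f x * (a * u i x + b * u j x))
        = s * a * (\<Sum>x\<in>set xs. u i x * u i x) + s * b * (\<Sum>x\<in>set xs. u i x * u j x)
          + t * a * (\<Sum>x\<in>set xs. u j x * u i x) + t * b * (\<Sum>x\<in>set xs. u j x * u j x)"
        unfolding sum_distrib_left sum.distrib[symmetric]
        by (rule sum.cong) (auto simp: f_def algebra_simps)
      then show ?thesis using ij by (simp add: u(2))
    qed
    have "(\<Sum>x\<in>set xs. f x) = 0"
      using st(1) by (simp add: f_def sum.distrib sum_distrib_left[symmetric])
    from form[OF this] have "c * (\<Sum>x\<in>set xs. (f x)\<^sup>2) \<le> kernel_form (set xs) K f" .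
    also have "(\<Sum>x\<in>set xs. (f x)\<^sup>2) = s\<^sup>2 + t\<^sup>2"
      using inner[of s t] by (simp add: f_def power2_eq_square)
    also have "kernel_form (set xs) K f = (\<Sum>x\<in>set xs. f x * (s * d i * u i x + t * d j * u j x))"
      unfolding kernel_form_def
    proof (rule sum.cong)
      fix x assume x: "x \<in> set xs"
      have "(\<Sum>y\<in>set xs. K x y * f y)
          = s * (\<Sum>y\<in>set xs. K x y * u i y) + t * (\<Sum>y\<in>set xs. K x y * u j y)"
        unfolding sum_distrib_left sum.distrib[symmetric]
        by (rule sum.cong) (auto simp: f_def algebra_simps)
      then show "f x * (\<Sum>y\<in>set xs. K x y * f y) = f x * (s * d i * u i x + t * d j * u j x)"
        using ij x by (simp add: u(1))
    qed simp
    also have "\<dots> = s\<^sup>2 * d i + t\<^sup>2 * d j"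
      by (simp add: inner power2_eq_square)
    finally have "s\<^sup>2 * (c - d i) + t\<^sup>2 * (c - d j) \<le> 0" by (simp add: algebra_simps)
    moreover have "0 \<le> s\<^sup>2 * (c - d i)" "0 \<le> t\<^sup>2 * (c - d j)" using neg by auto
    moreover have "0 < s\<^sup>2 * (c - d i) \<or> 0 < t\<^sup>2 * (c - d j)" using neg st(2) by auto
    ultimately show False by linarith
  qed
  then show ?thesis
    unfolding eigenvalue_list_eq_sort[OF cp] by (intro second_smallest_ge xs)
qed

text \<open>On the plane spanned by \<open>f\<close> and the constants the form is at most \<open>c\<close> times the square norm. If all
eigenvalues but one exceeded \<open>c\<close>, a nonzero function of this plane orthogonal to the exceptional
eigenfunction would violate that.\<close>
lemma second_eigenvalue_le:
  fixes K :: "'a \<Rightarrow> 'a \<Rightarrow> real"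
  assumes dist: "distinct xs"
      and sym: "\<And>x y. x \<in> set xs \<Longrightarrow> y \<in> set xs \<Longrightarrow> K x y = K y x"
      and row: "\<And>x. x \<in> set xs \<Longrightarrow> (\<Sum>y\<in>set xs. K x y) = 0"
      and f: "(\<Sum>x\<in>set xs. f x) = 0" "x0 \<in> set xs" "f x0 \<noteq> 0"
      and form: "kernel_form (set xs) K f \<le> c * (\<Sum>x\<in>set xs. (f x)\<^sup>2)" and c: "0 \<le> c"
  shows "eigenvalue_list (kernel_matrix xs K) ! 1 \<le> c"
proof -
  obtain u d where "orthonormal_eigenbasis xs K u d"
    using kernel_eigenbasis[of xs K] dist sym by blast
  then have u:
    "\<And>k x. k < length xs \<Longrightarrow> x \<in> set xs \<Longrightarrow> (\<Sum>y\<in>set xs. K x y * u k y) = d k * u k x"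
    "\<And>k l. k < length xs \<Longrightarrow> l < length xs \<Longrightarrow>
        (\<Sum>x\<in>set xs. u k x * u l x) = (if k = l then 1 else 0)"
    "\<And>f. (\<Sum>x\<in>set xs. (f x)\<^sup>2) = (\<Sum>k<length xs. (\<Sum>x\<in>set xs. u k x * f x)\<^sup>2)"
    "\<And>f. kernel_form (set xs) K f = (\<Sum>k<length xs. d k * (\<Sum>x\<in>set xs. u k x * f x)\<^sup>2)"
    and cp: "char_poly (kernel_matrix xs K) = (\<Prod>k<length xs. [:- d k, 1:])"
    by (simp_all add: orthonormal_eigenbasis_def)
  have col: "(\<Sum>x\<in>set xs. K x y) = 0" if "y \<in> set xs" for y
  proof -
    have "(\<Sum>x\<in>set xs. K x y) = (\<Sum>x\<in>set xs. K y x)"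
      by (rule sum.cong) (use sym that in auto)
    then show ?thesis using row[OF that] by simp
  qed
  have "\<exists>i<length xs. \<exists>j<length xs. i \<noteq> j \<and> d i \<le> c \<and> d j \<le> c"
  proof (rule ccontr)
    assume neg: "\<not> ?thesis"
    obtain k0 where k0: "\<And>k. k < length xs \<Longrightarrow> k \<noteq> k0 \<Longrightarrow> c < d k"
    proof (cases "\<exists>k0<length xs. d k0 \<le> c")
      case True
      then obtain k0 where "k0 < length xs" "d k0 \<le> c" by blast
      with neg show ?thesis by (intro that[of k0]) (meson not_le)
    next
      case False
      then show ?thesis by (intro that[of 0]) (meson not_le)
    qed
    obtain s t where st: "s * (\<Sum>x\<in>set xs. u k0 x) + t * (\<Sum>x\<in>set xs. u k0 x * f x) = 0" "s \<noteq> 0 \<or> t \<noteq> 0"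
      using exists_orthogonal_combination .
    define g where "g x = s + t * f x" for x
    define w where "w k = (\<Sum>x\<in>set xs. u k x * g x)" for k
    have "w k0 = s * (\<Sum>x\<in>set xs. u k0 x) + t * (\<Sum>x\<in>set xs. u k0 x * f x)"
      unfolding w_def sum_distrib_left sum.distrib[symmetric]
      by (rule sum.cong) (auto simp: g_def algebra_simps)
    with st(1) have "w k0 = 0" by simp
    have sq: "(\<Sum>x\<in>set xs. (g x)\<^sup>2) = s\<^sup>2 * real (length xs) + t\<^sup>2 * (\<Sum>x\<in>set xs. (f x)\<^sup>2)"
    proof -
      have "(\<Sum>x\<in>set xs. (g x)\<^sup>2)
          = (\<Sum>x\<in>set xs. s\<^sup>2) + 2 * s * t * (\<Sum>x\<in>set xs. f x) + t\<^sup>2 * (\<Sum>x\<in>set xs. (f x)\<^sup>2)"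
        unfolding sum_distrib_left sum.distrib[symmetric]
        by (rule sum.cong) (auto simp: g_def power2_eq_square algebra_simps)
      then show ?thesis using dist f(1) by (simp add: distinct_card)
    qed
    have len: "0 < length xs" using f(2) by (cases xs) auto
    have "0 < (f x0)\<^sup>2" using f(3) by simp
    also have "\<dots> \<le> (\<Sum>x\<in>set xs. (f x)\<^sup>2)"
      by (rule member_le_sum) (use f(2) in auto)
    finally have fpos: "0 < (\<Sum>x\<in>set xs. (f x)\<^sup>2)" .
    then have gpos: "0 < (\<Sum>x\<in>set xs. (g x)\<^sup>2)"
      unfolding sq using len st(2) by (auto intro: add_pos_nonneg add_nonneg_pos)
    define h where "h x = (\<Sum>y\<in>set xs. K x y * f y)" for x
    have hg: "(\<Sum>y\<in>set xs. K x y * g y) = t * h x" if "x \<in> set xs" for x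
    proof -
      have "(\<Sum>y\<in>set xs. K x y * g y) = s * (\<Sum>y\<in>set xs. K x y) + t * h x"
        unfolding h_def sum_distrib_left sum.distrib[symmetric]
        by (rule sum.cong) (auto simp: g_def algebra_simps)
      then show ?thesis by (simp add: row[OF that])
    qed
    have "(\<Sum>x\<in>set xs. h x) = (\<Sum>y\<in>set xs. (\<Sum>x\<in>set xs. K x y) * f y)"
      unfolding h_def by (subst sum.swap) (simp add: sum_distrib_right)
    then have h0: "(\<Sum>x\<in>set xs. h x) = 0" by (simp add: col)
    have "kernel_form (set xs) K g = (\<Sum>x\<in>set xs. g x * (t * h x))"
      by (simp add: kernel_form_def hg)
    also have "\<dots> = s * t * (\<Sum>x\<in>set xs. h x) + t\<^sup>2 * (\<Sum>x\<in>set xs. f x * h x)"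
      unfolding sum_distrib_left sum.distrib[symmetric]
      by (rule sum.cong) (auto simp: g_def power2_eq_square algebra_simps)
    also have "\<dots> = t\<^sup>2 * kernel_form (set xs) K f"
      unfolding h0 by (simp add: kernel_form_def h_def)
    also have "\<dots> \<le> t\<^sup>2 * (c * (\<Sum>x\<in>set xs. (f x)\<^sup>2))"
      using form by (rule mult_left_mono) simp
    also have "\<dots> \<le> c * (\<Sum>x\<in>set xs. (g x)\<^sup>2)"
      using c by (simp add: sq algebra_simps)
    also have "\<dots> = (\<Sum>k<length xs. c * (w k)\<^sup>2)"
      by (simp add: u(3) w_def sum_distrib_left)
    also have "\<dots> < (\<Sum>k<length xs. d k * (w k)\<^sup>2)"
    proof (rule sum_strict_mono_ex1)
      show "\<forall>k\<in>{..<length xs}. c * (w k)\<^sup>2 \<le> d k * (w k)\<^sup>2"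
      proof
        fix k assume "k \<in> {..<length xs}"
        then show "c * (w k)\<^sup>2 \<le> d k * (w k)\<^sup>2"
          using k0[of k] \<open>w k0 = 0\<close> by (cases "k = k0") (auto intro: mult_right_mono)
      qed
      have "(\<Sum>k<length xs. (w k)\<^sup>2) \<noteq> 0" using gpos by (simp add: u(3) w_def)
      then obtain k where k: "k < length xs" "w k \<noteq> 0"
        by (metis (no_types, lifting) lessThan_iff power_zero_numeral sum.neutral)
      then have "k \<noteq> k0" using \<open>w k0 = 0\<close> by auto
      with k k0[of k] show "\<exists>k\<in>{..<length xs}. c * (w k)\<^sup>2 < d k * (w k)\<^sup>2"
        by (intro bexI[of _ k]) auto
    qed simp
    also have "\<dots> = kernel_form (set xs) K g" by (simp add: u(4) w_def)
    finally show False by simp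
  qed
  then obtain i j where "i < length xs" "j < length xs" "i \<noteq> j" "d i \<le> c" "d j \<le> c" by blast
  then show ?thesis
    unfolding eigenvalue_list_eq_sort[OF cp] by (rule second_smallest_le)
qed

section \<open>Quadratic forms on a staircase\<close>

text \<open>Position \<open>j\<close> goes to position \<open>i + 1 - j\<close> when the top \<open>i \<ge> j\<close> pancakes are turned over, so with
\<open>k\<close> flips available the pairs \<open>(j, l)\<close> of positions that one flip exchanges are those with \<open>j + l \<le> k + 1\<close>.\<close>
definition staircase :: "nat \<Rightarrow> (nat \<times> nat) set" where
  "staircase k = Sigma {1..k} (\<lambda>j. {1..k + 1 - j})"

lemma finite_staircase [simp]: "finite (staircase k)"
  by (simp add: staircase_def)

lemma in_staircase: "(j, l) \<in> staircase k \<longleftrightarrow> 1 \<le> j \<and> 1 \<le> l \<and> j + l \<le> k + 1"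
  by (auto simp: staircase_def)

lemma sum_staircase_swap: "(\<Sum>(j,l)\<in>staircase k. g l j) = (\<Sum>(j,l)\<in>staircase k. g j l)"
  by (rule sum.reindex_bij_witness[where i = prod.swap and j = prod.swap])
     (auto simp: in_staircase)

definition staircase_form :: "nat \<Rightarrow> real \<Rightarrow> (nat \<Rightarrow> real) \<Rightarrow> real" where
  "staircase_form k c h = (\<Sum>(j,l)\<in>staircase k. ((h j)\<^sup>2 + (h l)\<^sup>2) / 2 - c * h j * h l)"

text \<open>The right-hand side is the form in which a Fourier mode of the flip Laplacian
produces it.\<close>
lemma staircase_form_alt:
  "staircase_form k c h = (\<Sum>j\<in>{1..k}. h j * (\<Sum>i\<in>{j..k}. h j - c * h (i + 1 - j)))"
proof -
  have "staircase_form k c h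
      = ((\<Sum>(j,l)\<in>staircase k. (h j)\<^sup>2) + (\<Sum>(j,l)\<in>staircase k. (h l)\<^sup>2)) / 2
        - (\<Sum>(j,l)\<in>staircase k. c * h j * h l)"
    unfolding staircase_form_def sum.distrib[symmetric] sum_divide_distrib sum_subtractf[symmetric]
    by (rule sum.cong) auto
  also have "(\<Sum>(j,l)\<in>staircase k. (h l)\<^sup>2) = (\<Sum>(j,l)\<in>staircase k. (h j)\<^sup>2)"
    by (rule sum_staircase_swap)
  also have "((\<Sum>(j,l)\<in>staircase k. (h j)\<^sup>2) + (\<Sum>(j,l)\<in>staircase k. (h j)\<^sup>2)) / 2
        - (\<Sum>(j,l)\<in>staircase k. c * h j * h l) = (\<Sum>(j,l)\<in>staircase k. h j * (h j - c * h l))"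
    by (simp add: sum_subtractf[symmetric] case_prod_unfold algebra_simps power2_eq_square)
  also have "\<dots> = (\<Sum>j\<in>{1..k}. h j * (\<Sum>l\<in>{1..k + 1 - j}. h j - c * h l))"
    unfolding staircase_def by (subst sum.Sigma[symmetric]) (auto simp: sum_distrib_left)
  also have "\<dots> = (\<Sum>j\<in>{1..k}. h j * (\<Sum>i\<in>{j..k}. h j - c * h (i + 1 - j)))"
  proof (rule sum.cong)
    fix j assume j: "j \<in> {1..k}"
    have "(\<Sum>l\<in>{1..k + 1 - j}. h j - c * h l) = (\<Sum>i\<in>{j..k}. h j - c * h (i + 1 - j))"
      by (rule sum.reindex_bij_witness[where i = "\<lambda>i. i + 1 - j" and j = "\<lambda>l. l + j - 1"])
         (use j in auto)
    then show "h j * (\<Sum>l\<in>{1..k + 1 - j}. h j - c * h l)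
        = h j * (\<Sum>i\<in>{j..k}. h j - c * h (i + 1 - j))" by simp
  qed simp
  finally show ?thesis .
qed

text \<open>Each summand is at least \<open>1 - \<bar>c\<bar>\<close> times the mean of the two squares, and every index \<open>j\<close> is met
by the pair \<open>(j, 1)\<close>.\<close>
lemma staircase_form_ge_contraction:
  assumes "\<bar>c\<bar> \<le> 1"
  shows "(1 - \<bar>c\<bar>) * (\<Sum>j\<in>{1..k}. (h j)\<^sup>2) \<le> staircase_form k c h"
proof -
  have "(\<Sum>j\<in>{1..k}. (h j)\<^sup>2) = (\<Sum>(j,l)\<in>(\<lambda>j. (j, 1::nat)) ` {1..k}. (h j)\<^sup>2)"
    by (subst sum.reindex) (auto simp: inj_on_def)
  also have "\<dots> \<le> (\<Sum>(j,l)\<in>staircase k. (h j)\<^sup>2)"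
    by (rule sum_mono2) (auto simp: in_staircase)
  also have "\<dots> = ((\<Sum>(j,l)\<in>staircase k. (h j)\<^sup>2) + (\<Sum>(j,l)\<in>staircase k. (h l)\<^sup>2)) / 2"
    by (subst sum_staircase_swap[of "\<lambda>l j. (h l)\<^sup>2"]) simp
  also have "\<dots> = (\<Sum>(j,l)\<in>staircase k. ((h j)\<^sup>2 + (h l)\<^sup>2) / 2)"
    by (simp add: sum.distrib[symmetric] sum_divide_distrib case_prod_unfold)
  finally have "(1 - \<bar>c\<bar>) * (\<Sum>j\<in>{1..k}. (h j)\<^sup>2)
      \<le> (1 - \<bar>c\<bar>) * (\<Sum>(j,l)\<in>staircase k. ((h j)\<^sup>2 + (h l)\<^sup>2) / 2)"
    using assms by (intro mult_left_mono) auto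
  also have "\<dots> \<le> staircase_form k c h"
    unfolding staircase_form_def sum_distrib_left
  proof (rule sum_mono, clarify)
    fix j l
    have "c * h j * h l \<le> \<bar>c\<bar> * (\<bar>h j\<bar> * \<bar>h l\<bar>)"
      by (metis abs_ge_self abs_mult mult.assoc)
    also have "\<dots> \<le> \<bar>c\<bar> * (((h j)\<^sup>2 + (h l)\<^sup>2) / 2)"
      using zero_le_power2[of "\<bar>h j\<bar> - \<bar>h l\<bar>"]
      by (intro mult_left_mono) (simp_all add: power2_diff)
    finally show "(1 - \<bar>c\<bar>) * (((h j)\<^sup>2 + (h l)\<^sup>2) / 2) \<le> ((h j)\<^sup>2 + (h l)\<^sup>2) / 2 - c * h j * h l"
      unfolding left_diff_distrib mult_1_left by (rule diff_left_mono)
  qed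
  finally show ?thesis .
qed

text \<open>All summands are squares \<open>(h\<^sub>j - h\<^sub>l)\<^sup>2 / 2\<close>, and those with \<open>j = 1\<close> or \<open>l = 1\<close> already suffice: for
\<open>h\<close> of sum zero, \<open>\<Sum>\<^sub>l (h\<^sub>1 - h\<^sub>l)\<^sup>2 = \<Sum>\<^sub>l h\<^sub>l\<^sup>2 + k h\<^sub>1\<^sup>2\<close>.\<close>
lemma staircase_form_ge_sum_zero:
  assumes "(\<Sum>j\<in>{1..k}. h j) = 0"
  shows "(\<Sum>j\<in>{1..k}. (h j)\<^sup>2) \<le> staircase_form k 1 h"
proof -
  let ?A = "(\<lambda>l. (1::nat, l)) ` {1..k}" and ?B = "(\<lambda>j. (j, 1::nat)) ` {2..k}"
  have summand: "((h j)\<^sup>2 + (h l)\<^sup>2) / 2 - 1 * h j * h l = (h j - h l)\<^sup>2 / 2" for j l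
    by (simp add: power2_diff field_simps)
  have "(\<Sum>l\<in>{1..k}. (h 1 - h l)\<^sup>2)
      = (\<Sum>l\<in>{1..k}. (h 1)\<^sup>2) - 2 * h 1 * (\<Sum>l\<in>{1..k}. h l) + (\<Sum>l\<in>{1..k}. (h l)\<^sup>2)"
    unfolding sum_distrib_left sum_subtractf[symmetric] sum.distrib[symmetric]
    by (rule sum.cong) (auto simp: power2_diff)
  then have "(\<Sum>j\<in>{1..k}. (h j)\<^sup>2) \<le> (\<Sum>l\<in>{1..k}. (h 1 - h l)\<^sup>2)"
    using assms by simp
  also have "\<dots> = (\<Sum>l\<in>{1..k}. (h 1 - h l)\<^sup>2 / 2) + (\<Sum>j\<in>{2..k}. (h j - h 1)\<^sup>2 / 2)"
  proof -
    have "(\<Sum>j\<in>{1..k}. (h j - h 1)\<^sup>2 / 2) = (\<Sum>j\<in>{2..k}. (h j - h 1)\<^sup>2 / 2)"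
    proof (rule sum.mono_neutral_right)
      have "{1..k} - {2..k} \<subseteq> {1}" by auto
      then show "\<forall>j\<in>{1..k} - {2..k}. (h j - h 1)\<^sup>2 / 2 = 0" by auto
    qed auto
    then have "(\<Sum>j\<in>{2..k}. (h j - h 1)\<^sup>2 / 2) = (\<Sum>l\<in>{1..k}. (h 1 - h l)\<^sup>2 / 2)"
      by (simp add: power2_commute)
    then show ?thesis by (simp add: sum_divide_distrib[symmetric])
  qed
  also have "\<dots> = (\<Sum>(j,l)\<in>?A. (h j - h l)\<^sup>2 / 2) + (\<Sum>(j,l)\<in>?B. (h j - h l)\<^sup>2 / 2)"
    by (simp add: sum.reindex inj_on_def)
  also have "\<dots> = (\<Sum>(j,l)\<in>?A \<union> ?B. (h j - h l)\<^sup>2 / 2)"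
    by (rule sum.union_disjoint[symmetric]) auto
  also have "\<dots> \<le> (\<Sum>(j,l)\<in>staircase k. (h j - h l)\<^sup>2 / 2)"
    by (rule sum_mono2) (auto simp: in_staircase)
  also have "\<dots> = staircase_form k 1 h"
    unfolding staircase_form_def summand ..
  finally show ?thesis .
qed

text \<open>\<open>2 - \<surd>2\<close> is the smaller eigenvalue of the matrix with rows \<open>(3, 1)\<close> and \<open>(1, 1)\<close>. The form
at \<open>c = -1\<close> contains one copy of it for every pair \<open>{j, k + 1 - j}\<close>.\<close>
lemma two_by_two_least_eigenvalue:
  "(2 - sqrt 2) * (a\<^sup>2 + b\<^sup>2) \<le> 2 * a\<^sup>2 + (a + b)\<^sup>2" for a b :: real
proof -
  have "2 * a\<^sup>2 + (a + b)\<^sup>2 - (2 - sqrt 2) * (a\<^sup>2 + b\<^sup>2)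
      = (sqrt 2 - 1) * ((sqrt 2 + 1) * a + b)\<^sup>2"
    by (simp add: power2_sum power2_eq_square algebra_simps)
  moreover have "0 \<le> (sqrt 2 - 1) * ((sqrt 2 + 1) * a + b)\<^sup>2" by simp
  ultimately show ?thesis by linarith
qed

text \<open>Keep only the antidiagonal pairs \<open>(j, k + 1 - j)\<close> and the diagonal pairs \<open>(j, j)\<close> strictly above
the antidiagonal. What is left is a direct sum of the \<open>2 \<times> 2\<close> forms just treated and, for odd \<open>k\<close>,
one middle term \<open>2 h\<^sub>j\<^sup>2\<close>.\<close>
lemma staircase_form_ge_alternating:
  "(2 - sqrt 2) * (\<Sum>j\<in>{1..k}. (h j)\<^sup>2) \<le> staircase_form k (- 1) h"
proof -
  define r where "r j = k + 1 - j" for j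
  let ?A = "(\<lambda>j. (j, r j)) ` {1..k}" and ?B = "(\<lambda>j. (j, j)) ` {j \<in> {1..k}. j < r j}"
  define t where "t j = (h j + h (r j))\<^sup>2 / 2 + (if j < r j then 2 * (h j)\<^sup>2 else 0)" for j
  have summand: "((h j)\<^sup>2 + (h l)\<^sup>2) / 2 - (- 1) * h j * h l = (h j + h l)\<^sup>2 / 2" for j l
    by (simp add: power2_sum field_simps)
  have swap: "(\<Sum>j\<in>{1..k}. g (r j)) = (\<Sum>j\<in>{1..k}. g j)" for g :: "nat \<Rightarrow> real"
    by (rule sum.reindex_bij_witness[where i = r and j = r]) (auto simp: r_def)
  have pair: "(2 - sqrt 2) * ((h j)\<^sup>2 + (h (r j))\<^sup>2) \<le> t j + t (r j)" if j: "j \<in> {1..k}" for j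
  proof -
    have rr: "r (r j) = j" using j by (auto simp: r_def)
    consider "j < r j" | "r j < j" | "j = r j" by linarith
    then show ?thesis
    proof cases
      case 1
      then show ?thesis using two_by_two_least_eigenvalue[of "h j" "h (r j)"]
        by (simp add: t_def rr add.commute)
    next
      case 2
      then show ?thesis using two_by_two_least_eigenvalue[of "h (r j)" "h j"]
        by (simp add: t_def rr add.commute)
    next
      case 3
      have "(2 - sqrt 2) * (h j)\<^sup>2 \<le> 2 * (h j)\<^sup>2" by (intro mult_right_mono) auto
      with 3 show ?thesis by (simp add: t_def power2_eq_square algebra_simps)
    qed
  qed
  have "2 * ((2 - sqrt 2) * (\<Sum>j\<in>{1..k}. (h j)\<^sup>2))
      = (\<Sum>j\<in>{1..k}. (2 - sqrt 2) * ((h j)\<^sup>2 + (h (r j))\<^sup>2))"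
    using swap[of "\<lambda>j. (h j)\<^sup>2"] by (simp add: sum_distrib_left[symmetric] sum.distrib)
  also have "\<dots> \<le> (\<Sum>j\<in>{1..k}. t j + t (r j))" by (rule sum_mono) (rule pair)
  also have "\<dots> = 2 * (\<Sum>j\<in>{1..k}. t j)" using swap[of t] by (simp add: sum.distrib)
  finally have "(2 - sqrt 2) * (\<Sum>j\<in>{1..k}. (h j)\<^sup>2) \<le> (\<Sum>j\<in>{1..k}. t j)" by simp
  also have "(\<Sum>j\<in>{1..k}. t j) = (\<Sum>(j,l)\<in>?A. (h j + h l)\<^sup>2 / 2) + (\<Sum>(j,l)\<in>?B. (h j + h l)\<^sup>2 / 2)"
    by (simp add: sum.reindex inj_on_def t_def sum.distrib sum.inter_filter[symmetric]
        power2_eq_square algebra_simps)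
  also have "\<dots> = (\<Sum>(j,l)\<in>?A \<union> ?B. (h j + h l)\<^sup>2 / 2)"
    by (rule sum.union_disjoint[symmetric]) auto
  also have "\<dots> \<le> (\<Sum>(j,l)\<in>staircase k. (h j + h l)\<^sup>2 / 2)"
    by (rule sum_mono2) (auto simp: in_staircase r_def)
  also have "\<dots> = staircase_form k (- 1) h"
    unfolding staircase_form_def summand ..
  finally show ?thesis .
qed

section \<open>Characters of the color group\<close>
lemma abs_cos_multiple_le:
  fixes t :: int and M :: nat
  assumes "M > 0" "\<not> int M dvd t"
  shows "\<bar>cos (pi * t / M)\<bar> \<le> cos (pi / M)"
proof -
  define s where "s = t mod int M"
  have s: "0 < s" "s < int M"
  proof -
    have "0 \<le> s" "s < int M" "s \<noteq> 0"
      using assms by (simp_all add: s_def dvd_eq_mod_eq_0)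
    then show "0 < s" "s < int M" by simp_all
  qed
  define q where "q = t div int M"
  have "t = s + q * int M" by (simp add: s_def q_def)
  then have "real_of_int t = s + q * real M" by simp
  then have "pi * t / M = pi * s / M + pi * q"
    using assms(1) by (simp add: field_simps)
  then have "\<bar>cos (pi * t / M)\<bar> = \<bar>cos (pi * s / M) * cos (pi * q)\<bar>"
    by (simp only: cos_add sin_npi_int)
  then have "\<bar>cos (pi * t / M)\<bar> = \<bar>cos (pi * s / M)\<bar>"
    by (simp add: abs_mult)
  moreover have "cos (pi * s / M) \<le> cos (pi / M)"
    using s by (intro cos_monotone_0_pi_le) (auto simp: field_simps)
  moreover have "cos (pi - pi / M) \<le> cos (pi * s / M)"
  proof (rule cos_monotone_0_pi_le)
    have "real_of_int s \<le> real M - 1" using s by linarith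
    then have "pi * s \<le> pi * (real M - 1)" by simp
    then show "pi * s / M \<le> pi - pi / M" using s by (simp add: field_simps)
  qed (use s in \<open>auto simp: field_simps\<close>)
  ultimately show ?thesis by (simp add: abs_le_iff)
qed

text \<open>For odd \<open>m\<close> the residue \<open>2 c\<close> is nonzero, so the angle \<open>\<pi> (2 c) / m\<close> is a proper
multiple of \<open>\<pi> / m\<close>. For \<open>m = 2 M\<close> it is a multiple of \<open>\<pi> / M\<close>, and the cosine reaches \<open>-1\<close> exactly for \<open>c = M\<close>.\<close>
lemma gap_const_le_character:
  fixes c m :: nat
  assumes m: "2 \<le> m" and c: "c < m" "c \<noteq> 0"
  shows "cos (2 * pi * c / m) = - 1 \<and> gap_const m \<le> 2 - sqrt 2
       \<or> gap_const m \<le> 1 - \<bar>cos (2 * pi * c / m)\<bar>"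
proof (cases "odd m")
  case True
  have "\<not> int m dvd 2 * int c"
  proof
    assume "int m dvd 2 * int c"
    moreover have "coprime (int m) 2" using True by (simp add: coprime_commute)
    ultimately have "int m dvd int c" by (simp add: coprime_dvd_mult_right_iff)
    with c show False by (auto dest: dvd_imp_le)
  qed
  from abs_cos_multiple_le[OF _ this] m True show ?thesis
    by (simp add: gap_const_def mult_ac)
next
  case False
  then obtain M where M: "m = 2 * M" by (auto elim: evenE)
  show ?thesis
  proof (cases "c = M")
    case True
    then show ?thesis using M m by (simp add: gap_const_def)
  next
    case False
    have "\<not> int M dvd int c"
    proof
      assume "int M dvd int c"
      then obtain k where k: "c = M * k" by (auto elim: dvdE)
      with c M have "k < 2" by simp
      with k c False show False by (cases k) auto
    qed
    from abs_cos_multiple_le[OF _ this] M m \<open>\<not> odd m\<close> show ?thesis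
      by (auto simp: gap_const_def mult_ac)
  qed
qed

lemma gap_const_le_one: "2 \<le> m \<Longrightarrow> gap_const m \<le> 1"
proof (cases "odd m")
  case True
  assume "2 \<le> m"
  then have "pi / m \<le> pi / 2" by (intro divide_left_mono) auto
  moreover have "0 \<le> pi / m" by simp
  ultimately have "0 \<le> cos (pi / m)" by (intro cos_ge_zero) linarith+
  with True show ?thesis by (simp add: gap_const_def)
next
  case False
  have "1 \<le> sqrt 2" by simp
  moreover have "gap_const m \<le> 2 - sqrt 2" using False by (simp add: gap_const_def)
  ultimately show ?thesis by linarith
qed

lemma gap_const_pos: "2 \<le> m \<Longrightarrow> 0 < gap_const m"
proof -
  assume m: "2 \<le> m"
  have "cos (pi / m) < cos 0"
    using m by (intro cos_monotone_0_pi) (auto simp: field_simps)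
  moreover have "cos (2 * pi / m) < cos 0"
    using m by (intro cos_monotone_0_pi) (auto simp: field_simps)
  moreover have "sqrt 2 < 2" by (rule real_less_lsqrt) auto
  ultimately show ?thesis by (simp add: gap_const_def)
qed

lemma staircase_eigenvalue_ge_gap_const:
  fixes h :: "nat \<Rightarrow> real" and c m :: nat
  assumes m: "2 \<le> m" "c < m"
      and ev: "\<And>j. j \<in> {1..k} \<Longrightarrow>
            (\<Sum>i\<in>{j..k}. h j - cos (2 * pi * c / m) * h (i + 1 - j)) = \<mu> * h j"
      and zero: "c = 0 \<Longrightarrow> (\<Sum>j\<in>{1..k}. h j) = 0"
      and nz: "j0 \<in> {1..k}" "h j0 \<noteq> 0"
  shows "gap_const m \<le> \<mu>"
proof -
  let ?N = "\<Sum>j\<in>{1..k}. (h j)\<^sup>2" and ?C = "cos (2 * pi * c / m)"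
  have "staircase_form k ?C h = (\<Sum>j\<in>{1..k}. h j * (\<mu> * h j))"
    unfolding staircase_form_alt by (rule sum.cong, simp, simp only: ev)
  then have form: "staircase_form k ?C h = \<mu> * ?N"
    by (simp add: sum_distrib_left power2_eq_square mult_ac)
  have "0 < (h j0)\<^sup>2" using nz by simp
  also have "\<dots> \<le> ?N" by (rule member_le_sum) (use nz in auto)
  finally have N: "0 < ?N" .
  have "\<exists>b\<ge>gap_const m. b * ?N \<le> staircase_form k ?C h"
  proof (cases "c = 0")
    case True
    then show ?thesis using staircase_form_ge_sum_zero[OF zero] gap_const_le_one[OF m(1)]
      by (intro exI[of _ 1]) auto
  next
    case False
    from gap_const_le_character[OF m this] show ?thesis
    proof (elim disjE conjE)
      assume "?C = - 1" "gap_const m \<le> 2 - sqrt 2"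
      then show ?thesis using staircase_form_ge_alternating[where k = k and h = h] by (intro exI[of _ "2 - sqrt 2"]) auto
    next
      assume "gap_const m \<le> 1 - \<bar>?C\<bar>"
      then show ?thesis using staircase_form_ge_contraction[where c = ?C and k = k and h = h]
        by (intro exI[of _ "1 - \<bar>?C\<bar>"]) auto
    qed
  qed
  then obtain b where b: "gap_const m \<le> b" "b * ?N \<le> \<mu> * ?N" by (auto simp: form)
  from b(2) N have "b \<le> \<mu>" by simp
  with b(1) show ?thesis by simp
qed

lemma cis_eq_1_imp_dvd:
  fixes t :: int and m :: nat
  assumes "m > 0" "cis (2 * pi * t / m) = 1"
  shows "int m dvd t"
proof -
  have "cos (2 * pi * t / m) = 1" using assms(2) by (simp add: cis.ctr complex_eq_iff)
  then obtain q :: int where "2 * pi * t / m = q * 2 * pi"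
    using cos_one_2pi_int by auto
  then have "real_of_int t = real_of_int (q * int m)" using assms(1) by (simp add: field_simps)
  then have "t = q * int m" by (simp only: of_int_eq_iff)
  then show ?thesis by simp
qed

lemma cis_eq_1_of_dvd:
  fixes t :: int and m :: nat
  assumes "m > 0" "int m dvd t"
  shows "cis (2 * pi * t / m) = 1"
proof -
  obtain q where "t = int m * q" using assms(2) by (elim dvdE)
  then have "2 * pi * t / m = 2 * pi * q" using assms(1) by simp
  then show ?thesis by (simp add: cis_multiple_2pi)
qed

lemma cis_mod:
  fixes a :: int and c m :: nat
  assumes "m > 0"
  shows "cis (2 * pi * c / m * (a mod int m)) = cis (2 * pi * c / m * a)"
proof -
  have "2 * pi * c / m * a = 2 * pi * c / m * (a mod int m) + 2 * pi * (int c * (a div int m) * int m) / m"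
  proof -
    have "real_of_int a = real_of_int (a mod int m) + real_of_int (a div int m) * m"
      by (metis mod_div_mult_eq of_int_add of_int_mult of_int_of_nat_eq)
    then show ?thesis using assms by (simp add: field_simps)
  qed
  moreover have "cis (2 * pi * (int c * (a div int m) * int m) / m) = 1"
    using cis_eq_1_of_dvd[OF assms, of "int c * (a div int m) * int m"] by simp
  ultimately show ?thesis by (metis cis_mult mult.right_neutral)
qed

lemma sum_characters:
  fixes a b :: int and m :: nat
  assumes m: "m > 0" and ab: "a \<in> {0..<int m}" "b \<in> {0..<int m}"
  shows "(\<Sum>c<m. cis (2 * pi * c / m * a) * cis (- (2 * pi * c / m * b))) = (if a = b then of_nat m else 0)"
proof -
  define z where "z = cis (2 * pi * (a - b) / m)"
  have "cis (2 * pi * c / m * a) * cis (- (2 * pi * c / m * b)) = z ^ c" for c :: nat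
    unfolding z_def DeMoivre cis_mult by (rule arg_cong[of _ _ cis]) (use m in \<open>simp add: field_simps\<close>)
  then have S: "(\<Sum>c<m. cis (2 * pi * c / m * a) * cis (- (2 * pi * c / m * b))) = (\<Sum>c<m. z ^ c)" by simp
  show ?thesis
  proof (cases "a = b")
    case True
    then show ?thesis unfolding S by (simp add: z_def)
  next
    case False
    have "z \<noteq> 1"
    proof
      assume "z = 1"
      then have "int m dvd a - b" using cis_eq_1_imp_dvd[OF m, of "a - b"] by (simp add: z_def)
      then have "a mod int m = b mod int m" by (simp add: mod_eq_dvd_iff)
      with ab False show False by simp
    qed
    moreover have "z ^ m = 1"
      using m cis_eq_1_of_dvd[OF m, of "int m * (a - b)"] by (simp add: z_def DeMoivre)
    ultimately show ?thesis unfolding S using False by (simp add: geometric_sum)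
  qed
qed

section \<open>Stacks of colored pancakes\<close>

text \<open>What the proof uses of the group of colored permutations: the label and the color
of the pancake at each position (position \<open>1\<close> is the top), and how the flips act on them.\<close>
locale colored_stacks =
  fixes X :: "'s set" and m n :: nat
    and lab :: "'s \<Rightarrow> nat \<Rightarrow> nat" and col :: "'s \<Rightarrow> nat \<Rightarrow> int"
    and flip :: "nat \<Rightarrow> int \<Rightarrow> 's \<Rightarrow> 's"
  assumes m: "2 \<le> m"
    and finite_X: "finite X" and X_ne: "X \<noteq> {}"
    and flip_in: "x \<in> X \<Longrightarrow> i \<in> {1..n} \<Longrightarrow> \<epsilon> \<in> {1, -1} \<Longrightarrow> flip i \<epsilon> x \<in> X"
    and lab_flip: "x \<in> X \<Longrightarrow> i \<in> {1..n} \<Longrightarrow> \<epsilon> \<in> {1, -1} \<Longrightarrow> j \<in> {1..n} \<Longrightarrow>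
          lab (flip i \<epsilon> x) j = lab x (if j \<le> i then i + 1 - j else j)"
    and col_flip: "x \<in> X \<Longrightarrow> i \<in> {1..n} \<Longrightarrow> \<epsilon> \<in> {1, -1} \<Longrightarrow> j \<in> {1..n} \<Longrightarrow>
          col (flip i \<epsilon> x) j = (if j \<le> i then (col x (i + 1 - j) + \<epsilon>) mod int m else col x j)"
    and col_range: "x \<in> X \<Longrightarrow> j \<in> {1..n} \<Longrightarrow> col x j \<in> {0..<int m}"
    and lab_bij: "x \<in> X \<Longrightarrow> bij_betw (lab x) {1..n} {1..n}"
    and stack_eqI: "x \<in> X \<Longrightarrow> y \<in> X \<Longrightarrow> (\<And>j. j \<in> {1..n} \<Longrightarrow> lab x j = lab y j)
          \<Longrightarrow> (\<And>j. j \<in> {1..n} \<Longrightarrow> col x j = col y j) \<Longrightarrow> x = y"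
begin

lemma flip_flip:
  assumes "x \<in> X" "i \<in> {1..n}" "\<epsilon> \<in> {1, -1}"
  shows "flip i (- \<epsilon>) (flip i \<epsilon> x) = x"
proof -
  have e: "- \<epsilon> \<in> {1, -1}" using assms(3) by auto
  have fx: "flip i \<epsilon> x \<in> X" using flip_in assms by blast
  show ?thesis
  proof (rule stack_eqI)
    show "flip i (- \<epsilon>) (flip i \<epsilon> x) \<in> X" using flip_in assms(2) e fx by blast
    fix j assume j: "j \<in> {1..n}"
    then have j': "(if j \<le> i then i + 1 - j else j) \<in> {1..n}" using assms(2) by auto
    show "lab (flip i (- \<epsilon>) (flip i \<epsilon> x)) j = lab x j"
      unfolding lab_flip[OF fx assms(2) e j] lab_flip[OF assms j'] using j assms(2) by auto
    have "(if j \<le> i then (col (flip i \<epsilon> x) (i + 1 - j) + - \<epsilon>) mod int m else col (flip i \<epsilon> x) j) = col x j"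
    proof (cases "j \<le> i")
      case True
      then have "i + 1 - j \<in> {1..n}" "i + 1 - j \<le> i" "i + 1 - (i + 1 - j) = j" using j assms(2) by auto
      then have "col (flip i \<epsilon> x) (i + 1 - j) = (col x j + \<epsilon>) mod int m"
        using col_flip[OF assms, of "i + 1 - j"] by simp
      then have "(col (flip i \<epsilon> x) (i + 1 - j) + - \<epsilon>) mod int m = col x j mod int m"
        by (simp add: mod_diff_left_eq)
      also have "\<dots> = col x j" using col_range[OF assms(1) j] by simp
      finally show ?thesis using True by simp
    next
      case False
      then show ?thesis using col_flip[OF assms j] by simp
    qed
    then show "col (flip i (- \<epsilon>) (flip i \<epsilon> x)) j = col x j"
      unfolding col_flip[OF fx assms(2) e j] .
  qed (use assms in auto)
qed

lemma flip_flip': "x \<in> X \<Longrightarrow> i \<in> {1..n} \<Longrightarrow> \<epsilon> \<in> {1, -1} \<Longrightarrow> flip i \<epsilon> (flip i (- \<epsilon>) x) = x"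
  using flip_flip[of x i "- \<epsilon>"] by auto

lemma sum_flip:
  assumes "i \<in> {1..n}" "\<epsilon> \<in> {1, -1}" "C \<subseteq> X"
      and "\<And>x. x \<in> C \<Longrightarrow> flip i \<epsilon> x \<in> C" "\<And>x. x \<in> C \<Longrightarrow> flip i (- \<epsilon>) x \<in> C"
  shows "(\<Sum>x\<in>C. g (flip i \<epsilon> x)) = (\<Sum>x\<in>C. g x)"
  by (rule sum.reindex_bij_witness[where i = "flip i (- \<epsilon>)" and j = "flip i \<epsilon>"])
     (use assms flip_flip flip_flip' in \<open>auto simp: subset_iff\<close>)

lemma sum_flip_X:
  assumes "i \<in> {1..n}" "\<epsilon> \<in> {1, -1}"
  shows "(\<Sum>x\<in>X. g (flip i \<epsilon> x)) = (\<Sum>x\<in>X. g x)"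
  by (rule sum_flip[OF assms]) (use flip_in assms in auto)

text \<open>The two signs are averaged, so that one definition serves both \<open>m = 2\<close>, where they give the
same flip, and \<open>m \<ge> 3\<close>.\<close>
definition lap_term :: "nat \<Rightarrow> ('s \<Rightarrow> real) \<Rightarrow> 's \<Rightarrow> real" where
  "lap_term i f x = f x - (f (flip i 1 x) + f (flip i (-1) x)) / 2"

definition lap :: "nat \<Rightarrow> ('s \<Rightarrow> real) \<Rightarrow> 's \<Rightarrow> real" where
  "lap k f x = (\<Sum>i\<in>{1..k}. lap_term i f x)"

text \<open>Flips of at most \<open>k\<close> pancakes do not touch the positions below \<open>k\<close>.\<close>
definition same :: "nat \<Rightarrow> 's \<Rightarrow> 's \<Rightarrow> bool" where
  "same k x y \<longleftrightarrow> (\<forall>j\<in>{k<..n}. lab x j = lab y j \<and> col x j = col y j)"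

definition cls :: "nat \<Rightarrow> 's \<Rightarrow> 's set" where
  "cls k x = {y \<in> X. same k x y}"

definition cls_sum :: "nat \<Rightarrow> ('s \<Rightarrow> real) \<Rightarrow> 's \<Rightarrow> real" where
  "cls_sum k f x = (\<Sum>y\<in>cls k x. f y)"

lemma finite_cls [simp]: "finite (cls k x)"
  using finite_X by (simp add: cls_def)

lemma cls_subset: "cls k x \<subseteq> X"
  by (auto simp: cls_def)

lemma same_flip:
  assumes "x \<in> X" "i \<in> {1..n}" "i \<le> k" "\<epsilon> \<in> {1, -1}"
  shows "same k x (flip i \<epsilon> x)"
  unfolding same_def
proof (intro ballI conjI)
  fix j assume "j \<in> {k<..n}"
  then have "j \<in> {1..n}" "\<not> j \<le> i" using assms by auto
  then show "lab x j = lab (flip i \<epsilon> x) j" "col x j = col (flip i \<epsilon> x) j"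
    using lab_flip[of x i \<epsilon> j] col_flip[of x i \<epsilon> j] assms by auto
qed

lemma cls_flip:
  assumes "y \<in> cls k x" "i \<in> {1..n}" "i \<le> k" "\<epsilon> \<in> {1, -1}"
  shows "flip i \<epsilon> y \<in> cls k x"
  using same_flip[of y i k \<epsilon>] flip_in[of y i \<epsilon>] assms by (auto simp: cls_def same_def)

lemma sum_flip_cls:
  assumes "i \<in> {1..n}" "i \<le> k" "\<epsilon> \<in> {1, -1}"
  shows "(\<Sum>y\<in>cls k x. g (flip i \<epsilon> y)) = (\<Sum>y\<in>cls k x. g y)"
  by (rule sum_flip[OF assms(1,3) cls_subset]) (use cls_flip assms in auto)

lemma sum_cls_lap:
  assumes "k \<le> n"
  shows "(\<Sum>y\<in>cls k x. lap k f y) = 0"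
proof -
  have "(\<Sum>y\<in>cls k x. lap_term i f y) = 0" if i: "i \<in> {1..k}" for i
  proof -
    have "(\<Sum>y\<in>cls k x. lap_term i f y) = (\<Sum>y\<in>cls k x. f y)
        - ((\<Sum>y\<in>cls k x. f (flip i 1 y)) + (\<Sum>y\<in>cls k x. f (flip i (-1) y))) / 2"
      unfolding lap_term_def sum_subtractf sum.distrib sum_divide_distrib[symmetric] ..
    also have "(\<Sum>y\<in>cls k x. f (flip i 1 y)) = (\<Sum>y\<in>cls k x. f y)"
      by (rule sum_flip_cls) (use i assms in auto)
    also have "(\<Sum>y\<in>cls k x. f (flip i (-1) y)) = (\<Sum>y\<in>cls k x. f y)"
      by (rule sum_flip_cls) (use i assms in auto)
    finally show ?thesis by simp
  qed
  then show ?thesis unfolding lap_def by (subst sum.swap) simp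
qed

lemma cls_cong: "y \<in> cls k x \<Longrightarrow> cls k y = cls k x"
  by (auto simp: cls_def same_def)

lemma sum_lap_term_nonneg:
  assumes i: "i \<in> {1..n}"
  shows "0 \<le> (\<Sum>x\<in>X. f x * lap_term i f x)"
proof -
  have sq: "(\<Sum>x\<in>X. (f (flip i \<epsilon> x))\<^sup>2) = (\<Sum>x\<in>X. (f x)\<^sup>2)" if "\<epsilon> \<in> {1,-1}" for \<epsilon>
    using sum_flip_X[OF i that, of "\<lambda>x. (f x)\<^sup>2"] .
  have "(\<Sum>x\<in>X. f x * lap_term i f x)
      = (\<Sum>x\<in>X. (f x - f (flip i 1 x))\<^sup>2 / 4 + (f x - f (flip i (-1) x))\<^sup>2 / 4
              + ((f x)\<^sup>2 - (f (flip i 1 x))\<^sup>2) / 4 + ((f x)\<^sup>2 - (f (flip i (-1) x))\<^sup>2) / 4)"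
    by (rule sum.cong) (auto simp: lap_term_def power2_eq_square field_simps)
  also have "\<dots> = (\<Sum>x\<in>X. (f x - f (flip i 1 x))\<^sup>2 / 4) + (\<Sum>x\<in>X. (f x - f (flip i (-1) x))\<^sup>2 / 4)"
    unfolding sum.distrib sum_divide_distrib[symmetric] sum_subtractf by (simp add: sq)
  also have "\<dots> \<ge> 0" by (intro add_nonneg_nonneg sum_nonneg) auto
  finally show ?thesis .
qed

text \<open>The Fourier transform, in the color, of the distribution of the pancake \<open>p\<close> over the stacks of one
class, weighted by \<open>f\<close>.\<close>
definition fourier :: "nat \<Rightarrow> 's \<Rightarrow> nat \<Rightarrow> ('s \<Rightarrow> real) \<Rightarrow> nat \<Rightarrow> nat \<Rightarrow> complex" where
  "fourier k x p f c j =
     (\<Sum>y\<in>cls k x. if lab y j = p then of_real (f y) * cis (2 * pi * c / m * col y j) else 0)"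

text \<open>Reindexing the sum by the inverse flip moves the pancake from \<open>j\<close> to
\<open>i + 1 - j\<close>; the change of its color becomes a phase.\<close>
lemma fourier_flip:
  assumes i: "i \<in> {1..n}" "i \<le> k" and e: "\<epsilon> \<in> {1, -1}" and j: "j \<in> {1..n}"
  shows "fourier k x p (\<lambda>y. f (flip i \<epsilon> y)) c j =
     (if j \<le> i then cis (- (2 * pi * c / m * \<epsilon>)) * fourier k x p f c (i + 1 - j) else fourier k x p f c j)"
proof -
  have e': "- \<epsilon> \<in> {1, -1}" using e by auto
  let ?\<theta> = "2 * pi * c / m"
  define g where "g z = (if lab (flip i (- \<epsilon>) z) j = p
      then of_real (f z) * cis (?\<theta> * col (flip i (- \<epsilon>) z) j) else 0)" for z
  have "fourier k x p (\<lambda>y. f (flip i \<epsilon> y)) c j = (\<Sum>y\<in>cls k x. g (flip i \<epsilon> y))"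
    unfolding fourier_def g_def
    by (rule sum.cong) (use flip_flip i e cls_subset in \<open>auto simp: subset_iff\<close>)
  also have "\<dots> = (\<Sum>z\<in>cls k x. g z)" by (rule sum_flip_cls[OF i e])
  also have "\<dots> = (if j \<le> i then cis (- (?\<theta> * \<epsilon>)) * fourier k x p f c (i + 1 - j) else fourier k x p f c j)"
  proof (cases "j \<le> i")
    case True
    have "g z = cis (- (?\<theta> * \<epsilon>)) *
          (if lab z (i + 1 - j) = p then of_real (f z) * cis (?\<theta> * col z (i + 1 - j)) else 0)"
      if "z \<in> cls k x" for z
    proof -
      have z: "z \<in> X" using that cls_subset by blast
      have "cis (?\<theta> * col (flip i (- \<epsilon>) z) j) = cis (?\<theta> * (col z (i + 1 - j) + - \<epsilon>))"
        unfolding col_flip[OF z i(1) e' j] using True cis_mod[of m c "col z (i + 1 - j) + - \<epsilon>"] m by simp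
      also have "\<dots> = cis (- (?\<theta> * \<epsilon>)) * cis (?\<theta> * col z (i + 1 - j))"
        unfolding cis_mult by (rule arg_cong[of _ _ cis]) (use m in \<open>simp add: field_simps\<close>)
      finally show ?thesis
        using True by (simp add: g_def lab_flip[OF z i(1) e' j])
    qed
    then show ?thesis using True unfolding fourier_def by (simp add: sum_distrib_left)
  next
    case False
    then show ?thesis unfolding fourier_def g_def
      by (auto intro!: sum.cong simp: lab_flip[OF _ i(1) e' j] col_flip[OF _ i(1) e' j] subsetD[OF cls_subset])
  qed
  finally show ?thesis .
qed

text \<open>Averaging the phases for \<open>\<epsilon> = 1\<close> and \<open>\<epsilon> = -1\<close> leaves the real factor \<open>cos (2 \<pi> c / m)\<close>. Flips with
\<open>i < j\<close> fix the pancake at \<open>j\<close> and cancel.\<close>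
lemma fourier_lap:
  assumes k: "k \<le> n" and j: "j \<in> {1..k}"
  shows "fourier k x p (lap k f) c j =
     (\<Sum>i\<in>{j..k}. fourier k x p f c j - cos (2 * pi * c / m) * fourier k x p f c (i + 1 - j))"
proof -
  let ?F = "fourier k x p f c" and ?\<theta> = "2 * pi * c / m"
  have lin: "fourier k x p (lap k f) c j = (\<Sum>i\<in>{1..k}. ?F j
      - (fourier k x p (\<lambda>y. f (flip i 1 y)) c j + fourier k x p (\<lambda>y. f (flip i (-1) y)) c j) / 2)"
  proof -
    have "fourier k x p (lap k f) c j = (\<Sum>y\<in>cls k x. \<Sum>i\<in>{1..k}.
       if lab y j = p then of_real (lap_term i f y) * cis (?\<theta> * col y j) else 0)"
      unfolding fourier_def lap_def by (rule sum.cong) (auto simp: sum_distrib_right)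
    also have "\<dots> = (\<Sum>i\<in>{1..k}. \<Sum>y\<in>cls k x.
       if lab y j = p then of_real (lap_term i f y) * cis (?\<theta> * col y j) else 0)"
      by (rule sum.swap)
    also have "\<dots> = (\<Sum>i\<in>{1..k}. ?F j
      - (fourier k x p (\<lambda>y. f (flip i 1 y)) c j + fourier k x p (\<lambda>y. f (flip i (-1) y)) c j) / 2)"
      unfolding fourier_def sum.distrib[symmetric] sum_divide_distrib sum_subtractf[symmetric]
      by (intro sum.cong refl) (auto simp: lap_term_def field_simps)
    finally show ?thesis .
  qed
  have cos2: "cis (- ?\<theta>) + cis ?\<theta> = 2 * of_real (cos ?\<theta>)"
    by (simp add: complex_eq_iff)
  have summand: "?F j - (fourier k x p (\<lambda>y. f (flip i 1 y)) c j + fourier k x p (\<lambda>y. f (flip i (-1) y)) c j) / 2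
     = (if i \<in> {j..k} then ?F j - cos ?\<theta> * ?F (i + 1 - j) else 0)" if i: "i \<in> {1..k}" for i
  proof -
    have i': "i \<in> {1..n}" "i \<le> k" "j \<in> {1..n}" using i j k by auto
    show ?thesis
    proof (cases "j \<le> i")
      case True
      have "fourier k x p (\<lambda>y. f (flip i 1 y)) c j + fourier k x p (\<lambda>y. f (flip i (-1) y)) c j
          = (cis (- ?\<theta>) + cis ?\<theta>) * ?F (i + 1 - j)"
        using True i' fourier_flip[of i k 1 j x p f c] fourier_flip[of i k "-1" j x p f c]
        by (simp add: algebra_simps)
      then show ?thesis using True i unfolding cos2 by simp
    next
      case False
      then show ?thesis
        using i' fourier_flip[of i k 1 j x p f c] fourier_flip[of i k "-1" j x p f c] by simp
    qed
  qed
  have "fourier k x p (lap k f) c j = (\<Sum>i\<in>{1..k}. if i \<in> {j..k} then ?F j - cos ?\<theta> * ?F (i + 1 - j) else 0)"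
    unfolding lin by (rule sum.cong) (simp_all only: summand)
  also have "\<dots> = (\<Sum>i\<in>{1..k} \<inter> {j..k}. ?F j - cos ?\<theta> * ?F (i + 1 - j))"
    by (rule sum.inter_restrict[symmetric]) simp
  also have "{1..k} \<inter> {j..k} = {j..k}" using j by auto
  finally show ?thesis .
qed

text \<open>In a class that agrees with \<open>x\<close> below position \<open>k\<close>, the pancake that \<open>x\<close> has at position \<open>k\<close> is
always found at exactly one of the positions \<open>1, \<dots>, k\<close>.\<close>
lemma sum_fourier_trivial:
  assumes k: "k \<in> {1..n}" and x: "x \<in> X"
  shows "(\<Sum>j\<in>{1..k}. fourier k x (lab x k) f 0 j) = of_real (cls_sum k f x)"
proof -
  have one: "(\<Sum>j\<in>{1..k}. if lab y j = lab x k then of_real (f y) else 0) = complex_of_real (f y)"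
    if "y \<in> cls k x" for y
  proof -
    have y: "y \<in> X" "same k x y" using that by (auto simp: cls_def)
    have inj: "inj_on (lab y) {1..n}" "inj_on (lab x) {1..n}" and im: "lab y ` {1..n} = {1..n}" "lab x k \<in> {1..n}"
      using lab_bij[OF y(1)] lab_bij[OF x] k by (auto simp: bij_betw_def)
    obtain j0 where j0: "j0 \<in> {1..n}" "lab y j0 = lab x k" using im by (metis imageE)
    have "j0 \<le> k"
    proof (rule ccontr)
      assume "\<not> j0 \<le> k"
      with y(2) j0 have "lab x j0 = lab x k" by (auto simp: same_def)
      with inj(2) j0(1) k have "j0 = k" by (auto dest: inj_onD)
      with \<open>\<not> j0 \<le> k\<close> show False by simp
    qed
    have iff: "lab y j = lab x k \<longleftrightarrow> j = j0" if "j \<in> {1..k}" for j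
      using that j0 inj(1) k by (metis atLeastAtMost_iff inj_onD le_trans)
    have "(\<Sum>j\<in>{1..k}. if lab y j = lab x k then of_real (f y) else 0)
        = (\<Sum>j\<in>{1..k}. if j = j0 then complex_of_real (f y) else 0)"
      by (rule sum.cong) (simp_all only: iff)
    then show ?thesis using j0(1) \<open>j0 \<le> k\<close> by simp
  qed
  have "(\<Sum>j\<in>{1..k}. fourier k x (lab x k) f 0 j)
      = (\<Sum>y\<in>cls k x. \<Sum>j\<in>{1..k}. if lab y j = lab x k then of_real (f y) else 0)"
    unfolding fourier_def by (subst sum.swap) (simp cong: if_cong)
  also have "\<dots> = (\<Sum>y\<in>cls k x. complex_of_real (f y))"
    by (rule sum.cong) (simp_all only: one)
  finally show ?thesis by (simp add: cls_sum_def)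
qed

text \<open>The stacks of a \<open>k\<close>-class that carry the same pancake in the same color as \<open>x\<close> at position \<open>k\<close>
form the \<open>(k - 1)\<close>-class of \<open>x\<close>. So a nonzero class sum at level \<open>k - 1\<close> forces
some Fourier mode not to vanish.\<close>
lemma fourier_inversion:
  assumes k: "k \<in> {1..n}" and x: "x \<in> X"
  shows "(\<Sum>c<m. fourier k x (lab x k) f c k * cis (- (2 * pi * c / m * col x k)))
      = of_nat m * of_real (cls_sum (k - 1) f x)"
proof -
  have "(\<Sum>c<m. fourier k x (lab x k) f c k * cis (- (2 * pi * c / m * col x k)))
     = (\<Sum>y\<in>cls k x. \<Sum>c<m. if lab y k = lab x k then of_real (f y) *
           (cis (2 * pi * c / m * col y k) * cis (- (2 * pi * c / m * col x k))) else 0)"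
    unfolding fourier_def sum_distrib_right
    by (subst sum.swap) (auto intro!: sum.cong)
  also have "\<dots> = (\<Sum>y\<in>cls k x. if lab y k = lab x k \<and> col y k = col x k then of_nat m * of_real (f y) else 0)"
  proof (rule sum.cong)
    fix y assume "y \<in> cls k x"
    then have "y \<in> X" using cls_subset by blast
    then have "(\<Sum>c<m. cis (2 * pi * c / m * col y k) * cis (- (2 * pi * c / m * col x k)))
        = (if col y k = col x k then of_nat m else 0)"
      using sum_characters[of m "col y k" "col x k"] m col_range[OF _ k] x by simp
    then show "(\<Sum>c<m. if lab y k = lab x k then of_real (f y) *
           (cis (2 * pi * c / m * col y k) * cis (- (2 * pi * c / m * col x k))) else 0)
       = (if lab y k = lab x k \<and> col y k = col x k then of_nat m * complex_of_real (f y) else 0)"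
      by (cases "lab y k = lab x k") (simp_all only: if_True if_False simp_thms sum_distrib_left[symmetric], simp_all)
  qed simp
  also have "\<dots> = (\<Sum>y\<in>{y \<in> cls k x. lab y k = lab x k \<and> col y k = col x k}. of_nat m * complex_of_real (f y))"
    by (rule sum.inter_filter[symmetric]) simp
  also have "{y \<in> cls k x. lab y k = lab x k \<and> col y k = col x k} = cls (k - 1) x"
  proof -
    have "{k - 1<..n} = insert k {k<..n}" using k by auto
    then show ?thesis by (auto simp: cls_def same_def)
  qed
  finally show ?thesis by (simp add: cls_sum_def sum_distrib_left)
qed

text \<open>The case that is not inherited from fewer pancakes: some Fourier mode turns \<open>f\<close> into an
eigenvector of a staircase form. The cosine is real, so its real and imaginary parts are
eigenvectors too.\<close>
lemma eigenvalue_ge_of_cls_sum_nonzero: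
  assumes k: "k \<in> {1..n}"
      and ev: "\<And>x. x \<in> X \<Longrightarrow> lap k f x = \<mu> * f x"
      and zero: "\<And>x. x \<in> X \<Longrightarrow> cls_sum k f x = 0"
      and x: "x \<in> X" "cls_sum (k - 1) f x \<noteq> 0"
  shows "gap_const m \<le> \<mu>"
proof -
  let ?F = "fourier k x (lab x k) f"
  have "(\<Sum>c<m. ?F c k * cis (- (2 * pi * c / m * col x k))) \<noteq> 0"
    unfolding fourier_inversion[OF k x(1)] using x(2) m by simp
  then obtain c where "c < m" "?F c k \<noteq> 0"
    by (metis (no_types, lifting) lessThan_iff mult_zero_left sum.neutral)
  then have c: "c < m" "Re (?F c k) \<noteq> 0 \<or> Im (?F c k) \<noteq> 0" by (auto simp: complex_eq_iff)
  have eig: "(\<Sum>i\<in>{j..k}. ?F c j - cos (2 * pi * c / m) * ?F c (i + 1 - j)) = \<mu> * ?F c j" if j: "j \<in> {1..k}" for j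
  proof -
    have "fourier k x (lab x k) (lap k f) c j = \<mu> * ?F c j"
      unfolding fourier_def sum_distrib_left
      by (rule sum.cong) (auto simp: ev subsetD[OF cls_subset])
    then show ?thesis using fourier_lap[OF _ j, of x "lab x k" f c] k by simp
  qed
  have z: "(\<Sum>j\<in>{1..k}. ?F c j) = 0" if "c = 0"
    unfolding that using sum_fourier_trivial[OF k x(1), of f] zero[OF x(1)] by simp
  have Re: ?thesis if "Re (?F c k) \<noteq> 0"
  proof (rule staircase_eigenvalue_ge_gap_const[OF m c(1)])
    show "(\<Sum>i\<in>{j..k}. Re (?F c j) - cos (2 * pi * c / m) * Re (?F c (i + 1 - j))) = \<mu> * Re (?F c j)"
      if "j \<in> {1..k}" for j
      using arg_cong[OF eig[OF that], of Re] by simp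
    show "(\<Sum>j\<in>{1..k}. Re (?F c j)) = 0" if "c = 0"
      using arg_cong[OF z[OF that], of Re] by simp
    show "k \<in> {1..k}" using k by simp
  qed fact
  have Im: ?thesis if "Im (?F c k) \<noteq> 0"
  proof (rule staircase_eigenvalue_ge_gap_const[OF m c(1)])
    show "(\<Sum>i\<in>{j..k}. Im (?F c j) - cos (2 * pi * c / m) * Im (?F c (i + 1 - j))) = \<mu> * Im (?F c j)"
      if "j \<in> {1..k}" for j
      using arg_cong[OF eig[OF that], of Im] by simp
    show "(\<Sum>j\<in>{1..k}. Im (?F c j)) = 0" if "c = 0"
      using arg_cong[OF z[OF that], of Im] by simp
    show "k \<in> {1..k}" using k by simp
  qed fact
  show ?thesis using c(2) Re Im by blast
qed

section \<open>The lower bound\<close>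

text \<open>The matrix entries of \<open>lap k\<close>.\<close>
definition kern :: "nat \<Rightarrow> 's \<Rightarrow> 's \<Rightarrow> real" where
  "kern k x y = (\<Sum>i\<in>{1..k}. of_bool (y = x) - (of_bool (y = flip i 1 x) + of_bool (y = flip i (-1) x)) / 2)"

lemma sum_kern:
  assumes k: "k \<le> n" and x: "x \<in> X"
  shows "(\<Sum>y\<in>X. kern k x y * f y) = lap k f x"
proof -
  have pt: "(\<Sum>y\<in>X. of_bool (y = a) * f y) = f a" if "a \<in> X" for a
    using that finite_X by (simp add: of_bool_def if_distrib[of "\<lambda>t. t * _"] cong: if_cong)
  have "(\<Sum>y\<in>X. kern k x y * f y) = (\<Sum>i\<in>{1..k}. \<Sum>y\<in>X.
      (of_bool (y = x) - (of_bool (y = flip i 1 x) + of_bool (y = flip i (-1) x)) / 2) * f y)"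
    unfolding kern_def sum_distrib_right by (rule sum.swap)
  also have "\<dots> = (\<Sum>i\<in>{1..k}. lap_term i f x)"
  proof (rule sum.cong)
    fix i assume i: "i \<in> {1..k}"
    have "(\<Sum>y\<in>X. (of_bool (y = x) - (of_bool (y = flip i 1 x) + of_bool (y = flip i (-1) x)) / 2) * f y)
      = (\<Sum>y\<in>X. of_bool (y = x) * f y) - ((\<Sum>y\<in>X. of_bool (y = flip i 1 x) * f y)
          + (\<Sum>y\<in>X. of_bool (y = flip i (-1) x) * f y)) / 2"
      unfolding sum.distrib[symmetric] sum_divide_distrib sum_subtractf[symmetric]
      by (rule sum.cong) (auto simp: field_simps)
    also have "\<dots> = lap_term i f x"
      using pt x flip_in[OF x, of i 1] flip_in[OF x, of i "-1"] i k by (simp add: lap_term_def)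
    finally show "(\<Sum>y\<in>X. (of_bool (y = x) - (of_bool (y = flip i 1 x) + of_bool (y = flip i (-1) x)) / 2) * f y)
      = lap_term i f x" .
  qed simp
  finally show ?thesis by (simp add: lap_def)
qed

lemma kern_sym:
  assumes k: "k \<le> n" and xy: "x \<in> X" "y \<in> X"
  shows "kern k x y = kern k y x"
  unfolding kern_def
proof (rule sum.cong)
  fix i assume "i \<in> {1..k}"
  then have i: "i \<in> {1..n}" using k by auto
  have "y = flip i 1 x \<longleftrightarrow> x = flip i (-1) y" "y = flip i (-1) x \<longleftrightarrow> x = flip i 1 y"
    using flip_flip[OF _ i, of _ 1] flip_flip[OF _ i, of _ "-1"] xy by auto
  moreover have "(y = x) = (x = y)" by auto
  ultimately show "of_bool (y = x) - (of_bool (y = flip i 1 x) + of_bool (y = flip i (-1) x)) / 2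
      = (of_bool (x = y) - (of_bool (x = flip i 1 y) + of_bool (x = flip i (-1) y)) / 2 :: real)"
    by (simp only: add.commute)
qed simp

text \<open>On functions that are constant on the classes, \<open>lap k\<close> vanishes; the term with the class sums
raises the eigenvalue there to at least \<open>gap_const m\<close>, so that the bound
holds without a side condition on \<open>f\<close>. At \<open>k = 0\<close> the classes are singletons and the
class sum is \<open>f\<close> itself.\<close>
lemma form_bound:
  assumes "k \<le> n"
  shows "gap_const m * (\<Sum>x\<in>X. (f x)\<^sup>2) \<le> (\<Sum>x\<in>X. f x * (lap k f x + gap_const m * cls_sum k f x))"
  using assms
proof (induction k arbitrary: f)
  case 0
  have "cls_sum 0 f x = f x" if "x \<in> X" for x
  proof -
    have "cls 0 x = {x}" using that by (auto simp: cls_def same_def intro: stack_eqI)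
    then show ?thesis by (simp add: cls_sum_def)
  qed
  then have "(\<Sum>x\<in>X. f x * (lap 0 f x + gap_const m * cls_sum 0 f x)) = (\<Sum>x\<in>X. gap_const m * (f x)\<^sup>2)"
    by (intro sum.cong) (auto simp: lap_def power2_eq_square)
  then show ?case by (simp add: sum_distrib_left)
next
  case (Suc k)
  let ?\<alpha> = "gap_const m" and ?k = "Suc k"
  define K where "K x y = kern ?k x y + ?\<alpha> * of_bool (same ?k x y)" for x y
  have app: "(\<Sum>y\<in>X. K x y * g y) = lap ?k g x + ?\<alpha> * cls_sum ?k g x" if x: "x \<in> X" for g x
  proof -
    have "(\<Sum>y\<in>X. K x y * g y) = (\<Sum>y\<in>X. kern ?k x y * g y) + ?\<alpha> * (\<Sum>y\<in>X. if same ?k x y then g y else 0)"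
      unfolding sum_distrib_left sum.distrib[symmetric] K_def by (rule sum.cong) (auto simp: algebra_simps)
    also have "(\<Sum>y\<in>X. if same ?k x y then g y else 0) = cls_sum ?k g x"
      unfolding cls_sum_def cls_def using finite_X by (simp add: sum.inter_filter)
    finally show ?thesis by (simp add: sum_kern[OF Suc.prems x])
  qed
  have "?\<alpha> * (\<Sum>x\<in>X. (f x)\<^sup>2) \<le> kernel_form X K f"
  proof (rule kernel_form_ge_least_eigenvalue[OF finite_X])
    show "K x y = K y x" if "x \<in> X" "y \<in> X" for x y
      using kern_sym[OF Suc.prems that] by (auto simp: K_def same_def)
  next
    fix g \<mu>
    assume "\<And>x. x \<in> X \<Longrightarrow> (\<Sum>y\<in>X. K x y * g y) = \<mu> * g x" and nz: "\<exists>x\<in>X. g x \<noteq> 0"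
    then have ev: "lap ?k g x + ?\<alpha> * cls_sum ?k g x = \<mu> * g x" if "x \<in> X" for x
      using that by (simp add: app)
    show "?\<alpha> \<le> \<mu>"
    proof (cases "\<exists>x\<in>X. cls_sum ?k g x \<noteq> 0")
      case True
      then obtain x where x: "x \<in> X" "cls_sum ?k g x \<noteq> 0" by blast
      \<comment> \<open>Sum the eigenvalue equation over the class: the Laplacian drops out and the class sum is
        constant on the class.\<close>
      have "(\<Sum>y\<in>cls ?k x. lap ?k g y + ?\<alpha> * cls_sum ?k g y) = \<mu> * cls_sum ?k g x"
        unfolding cls_sum_def[of _ _ x] sum_distrib_left
        by (rule sum.cong) (use ev cls_subset in auto)
      moreover have "(\<Sum>y\<in>cls ?k x. ?\<alpha> * cls_sum ?k g y) = card (cls ?k x) * (?\<alpha> * cls_sum ?k g x)"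
        by (simp add: cls_sum_def cls_cong)
      ultimately have "\<mu> = card (cls ?k x) * ?\<alpha>"
        using x(2) Suc.prems by (simp add: sum.distrib sum_cls_lap)
      moreover have "cls ?k x \<noteq> {}" using x(1) by (auto simp: cls_def same_def)
      then have "1 \<le> card (cls ?k x)" by (simp add: Suc_le_eq card_gt_0_iff)
      then have "1 * ?\<alpha> \<le> card (cls ?k x) * ?\<alpha>"
        using gap_const_pos[OF m] by (intro mult_right_mono) auto
      ultimately show ?thesis by simp
    next
      case False
      then have lapg: "lap ?k g x = \<mu> * g x" if "x \<in> X" for x
        using ev[OF that] that by simp
      show ?thesis
      proof (cases "\<exists>x\<in>X. cls_sum k g x \<noteq> 0")
        case True
        then show ?thesis
          using eigenvalue_ge_of_cls_sum_nonzero[of ?k g \<mu>] lapg False Suc.prems by auto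
      next
        case no_cls: False
        have "?\<alpha> * (\<Sum>x\<in>X. (g x)\<^sup>2) \<le> (\<Sum>x\<in>X. g x * (lap k g x + ?\<alpha> * cls_sum k g x))"
          using Suc.IH Suc.prems by simp
        also have "\<dots> = (\<Sum>x\<in>X. g x * lap k g x)"
          using no_cls by (intro sum.cong) auto
        also have "\<dots> \<le> (\<Sum>x\<in>X. g x * lap k g x) + (\<Sum>x\<in>X. g x * lap_term ?k g x)"
          using sum_lap_term_nonneg[of ?k g] Suc.prems by simp
        also have "\<dots> = (\<Sum>x\<in>X. g x * lap ?k g x)"
          unfolding sum.distrib[symmetric] by (rule sum.cong) (simp_all add: lap_def algebra_simps)
        also have "\<dots> = \<mu> * (\<Sum>x\<in>X. (g x)\<^sup>2)"
          unfolding sum_distrib_left by (rule sum.cong) (simp_all add: lapg power2_eq_square)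
        finally have le: "?\<alpha> * (\<Sum>x\<in>X. (g x)\<^sup>2) \<le> \<mu> * (\<Sum>x\<in>X. (g x)\<^sup>2)" .
        obtain x0 where x0: "x0 \<in> X" "g x0 \<noteq> 0" using nz by blast
        then have "0 < (g x0)\<^sup>2" by simp
        also have "\<dots> \<le> (\<Sum>x\<in>X. (g x)\<^sup>2)" by (rule member_le_sum) (use x0 finite_X in auto)
        finally show ?thesis using le by simp
      qed
    qed
  qed
  also have "kernel_form X K f = (\<Sum>x\<in>X. f x * (lap ?k f x + ?\<alpha> * cls_sum ?k f x))"
    unfolding kernel_form_def by (rule sum.cong) (simp_all add: app)
  finally show ?case .
qed

lemma poincare_inequality:
  assumes "(\<Sum>x\<in>X. f x) = 0"
  shows "gap_const m * (\<Sum>x\<in>X. (f x)\<^sup>2) \<le> (\<Sum>x\<in>X. f x * lap n f x)"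
proof -
  have "cls_sum n f x = 0" for x
    using assms by (simp add: cls_sum_def cls_def same_def)
  then show ?thesis using form_bound[of n f] by simp
qed

section \<open>The upper bound\<close>

text \<open>Bottom pancakes are moved by the full flip only. The composition \<open>t\<close> of a full flip with \<open>-1\<close>, a
flip of the top pancake with \<open>+1\<close> and a full flip with \<open>+1\<close> fixes the bottom label and adds
\<open>1\<close> to the bottom color; as a bijection of the stacks it shows that \<open>f\<close> has sum zero.\<close>
lemma test_function:
  assumes n: "2 \<le> n"
  obtains f x0 where "(\<Sum>x\<in>X. f x) = 0" "x0 \<in> X" "f x0 \<noteq> (0::real)"
    "(\<Sum>x\<in>X. f x * lap n f x) = (\<Sum>x\<in>X. (f x)\<^sup>2)"
proof -
  obtain x0 where x0: "x0 \<in> X" using X_ne by blast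
  define p q where "p = lab x0 n" and "q = col x0 n"
  define q' where "q' = (q + 1) mod int m"
  define f :: "'s \<Rightarrow> real" where "f y = of_bool (lab y n = p \<and> col y n = q) - of_bool (lab y n = p \<and> col y n = q')" for y
  have n1: "n \<in> {1..n}" "1 \<in> {1..n}" using n by auto
  define t where "t y = flip n 1 (flip 1 1 (flip n (-1) y))" for y
  have tX: "(\<Sum>x\<in>X. g (t x)) = (\<Sum>x\<in>X. g x)" for g :: "'s \<Rightarrow> real"
  proof -
    have "(\<Sum>x\<in>X. g (t x)) = (\<Sum>x\<in>X. g (flip n 1 (flip 1 1 x)))"
      unfolding t_def using sum_flip_X[OF n1(1), of "-1" "\<lambda>x. g (flip n 1 (flip 1 1 x))"] by simp
    also have "\<dots> = (\<Sum>x\<in>X. g (flip n 1 x))"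
      using sum_flip_X[OF n1(2), of 1 "\<lambda>x. g (flip n 1 x)"] by simp
    also have "\<dots> = (\<Sum>x\<in>X. g x)"
      using sum_flip_X[OF n1(1), of 1 g] by simp
    finally show ?thesis .
  qed
  have t: "lab (t y) n = lab y n" "col (t y) n = (col y n + 1) mod int m" if y: "y \<in> X" for y
  proof -
    have y1: "flip n (-1) y \<in> X" and y2: "flip 1 1 (flip n (-1) y) \<in> X"
      using flip_in[OF y n1(1), of "-1"] flip_in[OF _ n1(2), of _ 1] by auto
    show "lab (t y) n = lab y n"
      unfolding t_def using y y1 y2 n1 by (simp add: lab_flip)
    show "col (t y) n = (col y n + 1) mod int m"
      unfolding t_def using y y1 y2 n1 by (simp add: col_flip mod_simps)
  qed
  have q: "q \<in> {0..<int m}" using col_range[OF x0 n1(1)] by (simp add: q_def)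
  have "(\<Sum>x\<in>X. of_bool (lab x n = p \<and> col x n = q) :: real)
      = (\<Sum>x\<in>X. of_bool (lab (t x) n = p \<and> col (t x) n = q'))"
  proof (rule sum.cong)
    fix x assume x: "x \<in> X"
    have "col x n = q \<longleftrightarrow> (col x n + 1) mod int m = q'"
    proof
      assume "(col x n + 1) mod int m = q'"
      then have "(col x n + 1 - 1) mod int m = (q + 1 - 1) mod int m"
        unfolding q'_def by (metis mod_diff_left_eq)
      then show "col x n = q" using q col_range[OF x n1(1)] by simp
    qed (simp add: q'_def)
    then show "of_bool (lab x n = p \<and> col x n = q)
       = (of_bool (lab (t x) n = p \<and> col (t x) n = q') :: real)" by (simp add: t[OF x])
  qed simp
  also have "\<dots> = (\<Sum>x\<in>X. of_bool (lab x n = p \<and> col x n = q'))"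
    using tX[of "\<lambda>x. of_bool (lab x n = p \<and> col x n = q')"] .
  finally have sum0: "(\<Sum>x\<in>X. f x) = 0" by (simp add: f_def sum_subtractf)
  \<comment> \<open>The two colors differ because \<open>m \<ge> 2\<close>; otherwise \<open>f\<close> would vanish.\<close>
  have "q' \<noteq> q"
  proof
    assume "q' = q"
    then have "(q + 1) mod int m = q mod int m" using q by (simp add: q'_def)
    then have "int m dvd 1" by (metis add_diff_cancel_left' mod_eq_dvd_iff)
    with m show False by simp
  qed
  then have fx0: "f x0 \<noteq> 0" by (auto simp: f_def p_def q_def)
  have lapf: "f x * lap n f x = (f x)\<^sup>2" if x: "x \<in> X" for x
  proof (cases "lab x n = p")
    case True
    have low: "lap_term i f x = 0" if "i \<in> {1..n - 1}" for i
    proof -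
      have i: "i \<in> {1..n}" "\<not> n \<le> i" using that n by auto
      have "f (flip i \<epsilon> x) = f x" if "\<epsilon> \<in> {1, -1}" for \<epsilon>
        unfolding f_def lab_flip[OF x i(1) that n1(1)] col_flip[OF x i(1) that n1(1)] using i(2) by simp
      then show ?thesis by (simp add: lap_term_def)
    qed
    have "lab x 1 \<noteq> p"
    proof
      assume "lab x 1 = p"
      then have "1 = n" using lab_bij[OF x] True n1 by (metis bij_betw_def inj_onD)
      with n show False by simp
    qed
    then have "f (flip n \<epsilon> x) = 0" if "\<epsilon> \<in> {1, -1}" for \<epsilon>
      unfolding f_def lab_flip[OF x n1(1) that n1(1)] by simp
    then have top: "lap_term n f x = f x" by (simp add: lap_term_def)
    have "{1..n} = insert n {1..n - 1}" using n by auto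
    then have "lap n f x = lap_term n f x + (\<Sum>i\<in>{1..n - 1}. lap_term i f x)"
      unfolding lap_def using n by simp
    then show ?thesis by (simp add: low top power2_eq_square)
  next
    case False
    then show ?thesis by (simp add: f_def)
  qed
  show ?thesis by (rule that[of f x0]) (use sum0 x0 fx0 lapf in auto)
qed

section \<open>The Cayley graph of the flips\<close>
definition nbrs :: "'s \<Rightarrow> 's set" where
  "nbrs x = (\<lambda>(i, \<epsilon>). flip i \<epsilon> x) ` ({1..n} \<times> {1, -1})"

lemma in_nbrs: "y \<in> nbrs x \<longleftrightarrow> (\<exists>i\<in>{1..n}. \<exists>\<epsilon>\<in>{1, -1}. y = flip i \<epsilon> x)"
  unfolding nbrs_def image_iff Bex_def split_paired_Ex mem_Times_iff by auto

definition deg :: nat where "deg = (if m = 2 then n else 2 * n)"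

lemma flip_eq_flip_iff:
  assumes x: "x \<in> X" and i: "i \<in> {1..n}" "i' \<in> {1..n}" and e: "\<epsilon> \<in> {1, -1}" "\<epsilon>' \<in> {1, -1}"
  shows "flip i \<epsilon> x = flip i' \<epsilon>' x \<longleftrightarrow> i = i' \<and> (m = 2 \<or> \<epsilon> = \<epsilon>')"
proof
  have one: "1 \<in> {1..n}" using i by auto
  assume eq: "flip i \<epsilon> x = flip i' \<epsilon>' x"
  then have "lab x i = lab x i'"
    using lab_flip[OF x i(1) e(1) one] lab_flip[OF x i(2) e(2) one] i by simp
  then have ii: "i = i'" using lab_bij[OF x] i by (auto simp: bij_betw_def dest: inj_onD)
  have "(col x i + \<epsilon>) mod int m = (col x i + \<epsilon>') mod int m"
    using col_flip[OF x i(1) e(1) one] col_flip[OF x i(2) e(2) one] i eq ii by simp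
  then have "int m dvd \<epsilon> - \<epsilon>'" by (simp add: mod_eq_dvd_iff)
  then have "int m dvd 2" if "\<epsilon> \<noteq> \<epsilon>'"
    using e that by (auto simp: dvd_minus_iff[of _ 2, symmetric] simp del: dvd_minus_iff)
  then have "m = 2 \<or> \<epsilon> = \<epsilon>'" using zdvd_imp_le[of "int m" 2] m by auto
  with ii show "i = i' \<and> (m = 2 \<or> \<epsilon> = \<epsilon>')" by simp
next
  assume ie: "i = i' \<and> (m = 2 \<or> \<epsilon> = \<epsilon>')"
  show "flip i \<epsilon> x = flip i' \<epsilon>' x"
  proof (cases "\<epsilon> = \<epsilon>'")
    case False
    then have m2: "m = 2" using ie by simp
    have par: "(a + \<epsilon>) mod int m = (a + \<epsilon>') mod int m" for a
      using e False m2 by (auto simp: mod_eq_dvd_iff)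
    show ?thesis
    proof (rule stack_eqI)
      show "flip i \<epsilon> x \<in> X" "flip i' \<epsilon>' x \<in> X" using flip_in x i e by auto
      fix j assume j: "j \<in> {1..n}"
      show "lab (flip i \<epsilon> x) j = lab (flip i' \<epsilon>' x) j"
        unfolding lab_flip[OF x i(1) e(1) j] lab_flip[OF x i(2) e(2) j] using ie by simp
      show "col (flip i \<epsilon> x) j = col (flip i' \<epsilon>' x) j"
        unfolding col_flip[OF x i(1) e(1) j] col_flip[OF x i(2) e(2) j] using ie par by simp
    qed
  qed (use ie in simp)
qed

lemma sum_nbrs:
  assumes x: "x \<in> X"
  shows "real n * (\<Sum>y\<in>nbrs x. g y) = real deg * (\<Sum>i\<in>{1..n}. (g (flip i 1 x) + g (flip i (-1) x)) / 2)"
    and "card (nbrs x) = deg"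
proof -
  have "(\<Sum>y\<in>nbrs x. g y) = (\<Sum>i\<in>{1..n}. g (flip i 1 x)) * (if m = 2 then 1 else 0)
      + (if m = 2 then 0 else (\<Sum>i\<in>{1..n}. g (flip i 1 x) + g (flip i (-1) x)))
      \<and> (m = 2 \<longrightarrow> (\<forall>i\<in>{1..n}. flip i (-1) x = flip i 1 x)) \<and> card (nbrs x) = (if m = 2 then n else 2 * n)"
  proof (cases "m = 2")
    case True
    have eq: "flip i (-1) x = flip i 1 x" if "i \<in> {1..n}" for i
      using flip_eq_flip_iff[OF x that that, of "-1" 1] True by simp
    have inj: "inj_on (\<lambda>i. flip i 1 x) {1..n}"
      using flip_eq_flip_iff[OF x, of _ _ 1 1] by (auto simp: inj_on_def)
    have "nbrs x = (\<lambda>i. flip i 1 x) ` {1..n}"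
      using eq unfolding set_eq_iff in_nbrs by auto
    with inj True eq show ?thesis by (simp add: sum.reindex card_image)
  next
    case False
    have inj: "inj_on (\<lambda>(i, \<epsilon>). flip i \<epsilon> x) ({1..n} \<times> {1, -1})"
      unfolding inj_on_def
    proof (intro ballI impI)
      fix u v assume u: "u \<in> {1..n} \<times> {1, - 1 :: int}" and v: "v \<in> {1..n} \<times> {1, - 1 :: int}"
        and eq: "(case u of (i, \<epsilon>) \<Rightarrow> flip i \<epsilon> x) = (case v of (i, \<epsilon>) \<Rightarrow> flip i \<epsilon> x)"
      obtain i e i' e' where uv: "u = (i, e)" "v = (i', e')" by (cases u, cases v)
      show "u = v"
        using flip_eq_flip_iff[OF x, of i i' e e'] u v eq False unfolding uv by auto
    qed
    have "(\<Sum>y\<in>nbrs x. g y) = (\<Sum>(i, \<epsilon>)\<in>{1..n} \<times> {1, -1}. g (flip i \<epsilon> x))"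
      unfolding nbrs_def by (subst sum.reindex[OF inj]) (simp add: case_prod_unfold)
    also have "\<dots> = (\<Sum>i\<in>{1..n}. g (flip i 1 x) + g (flip i (-1) x))"
      by (subst sum.cartesian_product[symmetric]) simp
    finally show ?thesis
      using False card_image[OF inj] by (simp add: nbrs_def card_cartesian_product)
  qed
  then show "real n * (\<Sum>y\<in>nbrs x. g y) = real deg * (\<Sum>i\<in>{1..n}. (g (flip i 1 x) + g (flip i (-1) x)) / 2)"
    "card (nbrs x) = deg"
    by (auto simp: deg_def sum_divide_distrib[symmetric] sum.distrib split: if_splits)
qed

lemma nbrs_sym:
  assumes "x \<in> X" "y \<in> nbrs x"
  shows "y \<in> X" "x \<in> nbrs y"
proof -
  obtain i \<epsilon> where i: "i \<in> {1..n}" "\<epsilon> \<in> {1, -1}" "y = flip i \<epsilon> x"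
    using assms(2) unfolding in_nbrs by blast
  show "y \<in> X" using flip_in i assms(1) by blast
  have "x = flip i (- \<epsilon>) y" using flip_flip[OF assms(1) i(1,2)] i(3) by simp
  moreover have "- \<epsilon> \<in> {1, -1}" using i by auto
  ultimately show "x \<in> nbrs y" unfolding in_nbrs using i(1) by blast
qed

text \<open>The normalized Laplacian acts as \<open>lap n f / n\<close>, so both estimates carry over with a factor \<open>1 / n\<close>.\<close>
theorem spectral_gap_bounds:
  assumes n: "2 \<le> n"
  defines "\<G> \<equiv> (X, {{x, y} | x y. x \<in> X \<and> y \<in> nbrs x})"
  shows "gap_const m / real n \<le> spectral_gap \<G>" "spectral_gap \<G> \<le> 1 / real n"
proof -
  have edge: "{x, y} \<in> edges \<G> \<longleftrightarrow> y \<in> nbrs x" if "x \<in> X" for x y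
  proof
    assume "{x, y} \<in> edges \<G>"
    then obtain x' y' where xy': "{x, y} = {x', y'}" "x' \<in> X" "y' \<in> nbrs x'"
      unfolding \<G>_def edges_def by auto
    then consider "x = x'" "y = y'" | "x = y'" "y = x'" by (auto simp: doubleton_eq_iff)
    then show "y \<in> nbrs x" using xy' nbrs_sym(2)[OF xy'(2,3)] by cases auto
  next
    assume "y \<in> nbrs x"
    then show "{x, y} \<in> edges \<G>" using that unfolding \<G>_def edges_def by auto
  qed
  have V: "verts \<G> = X" by (simp add: \<G>_def verts_def)
  have deg: "vertex_degree \<G> x = deg" if x: "x \<in> X" for x
  proof -
    have "{e \<in> edges \<G>. x \<in> e} = (\<lambda>y. {x, y}) ` nbrs x"
    proof (intro equalityI subsetI)
      fix e assume "e \<in> {e \<in> edges \<G>. x \<in> e}"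
      then obtain x' y' where e: "e = {x', y'}" "x' \<in> X" "y' \<in> nbrs x'" "x = x' \<or> x = y'"
        unfolding \<G>_def edges_def by auto
      from e(4) show "e \<in> (\<lambda>y. {x, y}) ` nbrs x"
      proof
        assume "x = y'"
        then have "x' \<in> nbrs x" "e = {x, x'}" using nbrs_sym(2)[OF e(2,3)] e(1) by auto
        then show ?thesis by blast
      qed (use e in blast)
    next
      fix e assume "e \<in> (\<lambda>y. {x, y}) ` nbrs x"
      then show "e \<in> {e \<in> edges \<G>. x \<in> e}" using edge[OF x] by auto
    qed
    moreover have "inj_on (\<lambda>y. {x, y}) (nbrs x)"
      by (auto simp: inj_on_def doubleton_eq_iff)
    ultimately show ?thesis by (simp add: vertex_degree_def card_image sum_nbrs(2)[OF x])
  qed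
  have reg: "regular_degree \<G> = deg"
    unfolding regular_degree_def V using X_ne deg by (intro the_equality) auto
  have degpos: "0 < deg" using n by (simp add: deg_def)
  define xs where "xs = vertex_list \<G>"
  have xs: "distinct xs" "set xs = X"
  proof -
    have "\<exists>xs. distinct xs \<and> set xs = verts \<G>"
      unfolding V using finite_distinct_list[OF finite_X] by auto
    from someI_ex[OF this] show "distinct xs" "set xs = X"
      by (auto simp: xs_def vertex_list_def V)
  qed
  define K where "K x y = of_bool (x = y) - 1 / real deg * of_bool (y \<in> nbrs x)" for x y
  have nl: "normalized_laplacian \<G> = kernel_matrix xs K"
  proof (rule eq_matI)
    fix i j assume "i < dim_row (kernel_matrix xs K)" "j < dim_col (kernel_matrix xs K)"
    then have ij: "i < length xs" "j < length xs" by (auto simp: kernel_matrix_def)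
    then have "xs ! i \<in> X" using xs by auto
    then show "normalized_laplacian \<G> $$ (i,j) = kernel_matrix xs K $$ (i,j)"
      using ij xs(1) by (simp add: normalized_laplacian_def adjacency_matrix_def kernel_matrix_def
          K_def reg xs_def[symmetric] Let_def edge nth_eq_iff_index_eq)
  qed (simp_all add: normalized_laplacian_def adjacency_matrix_def kernel_matrix_def xs_def Let_def)
  have Ksym: "K x y = K y x" if "x \<in> set xs" "y \<in> set xs" for x y
  proof -
    have "x \<in> nbrs y \<longleftrightarrow> y \<in> nbrs x" using that nbrs_sym(2) unfolding xs(2) by blast
    then show ?thesis by (auto simp: K_def)
  qed
  have app: "(\<Sum>y\<in>X. K x y * f y) = lap n f x / n" if x: "x \<in> X" for f x
  proof -
    have nX: "nbrs x \<subseteq> X" using nbrs_sym x by blast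
    have "(\<Sum>y\<in>X. K x y * f y) = (\<Sum>y\<in>X. if y = x then f y else 0) - 1 / deg * (\<Sum>y\<in>X. if y \<in> nbrs x then f y else 0)"
      unfolding sum_distrib_left sum_subtractf[symmetric] K_def by (rule sum.cong) (auto simp: algebra_simps)
    also have "(\<Sum>y\<in>X. if y = x then f y else 0) = f x" using x finite_X by simp
    also have "(\<Sum>y\<in>X. if y \<in> nbrs x then f y else 0) = (\<Sum>y\<in>nbrs x. f y)"
      using sum.inter_restrict[OF finite_X, of f "nbrs x"] nX by (simp add: Int_absorb1)
    also have "1 / deg * (\<Sum>y\<in>nbrs x. f y) = (\<Sum>i\<in>{1..n}. (f (flip i 1 x) + f (flip i (-1) x)) / 2) / n"
      (is "_ = ?T / n")
    proof -
      have "(\<Sum>y\<in>nbrs x. f y) / deg = ?T / n"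
        using sum_nbrs(1)[OF x, of f] degpos n by (subst frac_eq_eq) (auto simp: mult.commute)
      then show ?thesis by simp
    qed
    also have "f x - (\<Sum>i\<in>{1..n}. (f (flip i 1 x) + f (flip i (-1) x)) / 2) / n = lap n f x / n"
      using n by (simp add: lap_def lap_term_def sum_subtractf diff_divide_distrib)
    finally show ?thesis .
  qed
  have form: "kernel_form (set xs) K f = (\<Sum>x\<in>X. f x * lap n f x) / n" for f
    unfolding kernel_form_def xs(2) sum_divide_distrib by (rule sum.cong) (simp_all add: app)
  obtain f x0 where f: "(\<Sum>x\<in>X. f x) = 0" "x0 \<in> X" "f x0 \<noteq> 0"
    "(\<Sum>x\<in>X. f x * lap n f x) = (\<Sum>x\<in>X. (f x)\<^sup>2)"
    using test_function[OF n] by blast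
  have "2 \<le> length xs"
  proof (rule ccontr)
    assume "\<not> 2 \<le> length xs"
    moreover have "0 < card X" using finite_X X_ne by (simp add: card_gt_0_iff)
    ultimately have "card X = 1" using distinct_card[OF xs(1)] unfolding xs(2) by linarith
    then have "X = {x0}" using f(2) by (metis card_1_singletonE singletonD)
    with f(1,3) show False by simp
  qed
  then show "gap_const m / real n \<le> spectral_gap \<G>"
    unfolding spectral_gap_def nl
  proof (rule second_eigenvalue_ge[OF xs(1) _ Ksym])
    fix g :: "'s \<Rightarrow> real" assume "(\<Sum>x\<in>set xs. g x) = 0"
    then show "gap_const m / real n * (\<Sum>x\<in>set xs. (g x)\<^sup>2) \<le> kernel_form (set xs) K g"
      using poincare_inequality[of g] n unfolding form unfolding xs(2) by (simp add: divide_right_mono)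
  qed
  show "spectral_gap \<G> \<le> 1 / real n"
    unfolding spectral_gap_def nl
  proof (rule second_eigenvalue_le[OF xs(1) Ksym])
    show "(\<Sum>y\<in>set xs. K x y) = 0" if "x \<in> set xs" for x
      using app[of x "\<lambda>_. 1"] that xs by (simp add: lap_def lap_term_def)
    show "(\<Sum>x\<in>set xs. f x) = 0" "x0 \<in> set xs" "f x0 \<noteq> 0" using f xs by auto
    show "kernel_form (set xs) K f \<le> 1 / real n * (\<Sum>x\<in>set xs. (f x)\<^sup>2)"
      unfolding form unfolding xs(2) f(4) by simp
  qed auto
qed

end

section \<open>Colored permutations as stacks\<close>
lemma inv_prefix_reversal: "inv_into UNIV (prefix_reversal i) = prefix_reversal i"
  by (rule inv_equality) (auto simp: prefix_reversal_def)

lemma prefix_reversal_permutes: "i \<le> n \<Longrightarrow> prefix_reversal i permutes {1..n}"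
  by (rule bij_imp_permutes) 
     (auto simp: prefix_reversal_def intro!: bij_betw_byWitness[where f' = "prefix_reversal i"])

lemma carrier_colored_perm_group:
  "0 < m \<Longrightarrow> carrier (colored_perm_group m n) = (\<Pi>\<^sub>E j\<in>{1..n}. {0..<int m}) \<times> {\<sigma>. \<sigma> permutes {1..n}}"
  by (simp add: colored_perm_group_def color_group_def carrier_integer_mod_group sym_group_def)

lemma mult_colored_perm_group:
  "(c, \<rho>) \<otimes>\<^bsub>colored_perm_group m n\<^esub> (a, \<sigma>)
    = ((\<lambda>j\<in>{1..n}. (c j + a (inv_into UNIV \<rho> j)) mod int m), \<rho> \<circ> \<sigma>)"
  by (auto simp: colored_perm_group_def color_group_def sym_group_def perm_act_def fun_eq_iff)

definition flip_stack ::
  "nat \<Rightarrow> nat \<Rightarrow> nat \<Rightarrow> int \<Rightarrow> (nat \<Rightarrow> int) \<times> (nat \<Rightarrow> nat) \<Rightarrow> (nat \<Rightarrow> int) \<times> (nat \<Rightarrow> nat)" where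
  "flip_stack m n i \<epsilon> x = (color_shift m n i \<epsilon>, prefix_reversal i) \<otimes>\<^bsub>colored_perm_group m n\<^esub> x"

text \<open>\<open>(a, \<sigma>)\<close> has the label \<open>\<sigma>\<^sup>-\<^sup>1 j\<close> at position \<open>j\<close>. Since the prefix reversal is its own inverse,
the action on color vectors moves colors in the same way as left multiplication moves labels.\<close>
lemma colored_stacks_colored_perm_group:
  assumes "2 \<le> m"
  shows "colored_stacks (carrier (colored_perm_group m n)) m n
    (\<lambda>x. inv_into UNIV (snd x)) fst (flip_stack m n)"
proof
  have m: "0 < m" using assms by simp
  let ?X = "carrier (colored_perm_group m n)"
  note carr = carrier_colored_perm_group[OF m]
  show "2 \<le> m" by fact
  show "finite ?X" unfolding carr by (auto intro: finite_PiE finite_permutations)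
  have "((\<lambda>j\<in>{1..n}. 0), id) \<in> ?X" unfolding carr using m by (auto simp: permutes_id)
  then show "?X \<noteq> {}" by blast
  fix x i \<epsilon> assume x: "x \<in> ?X" and i: "i \<in> {1..n}" and e: "\<epsilon> \<in> {1, -1 :: int}"
  obtain a \<sigma> where a: "x = (a, \<sigma>)" "a \<in> (\<Pi>\<^sub>E j\<in>{1..n}. {0..<int m})" "\<sigma> permutes {1..n}"
    using x unfolding carr by auto
  have flip: "flip_stack m n i \<epsilon> x = ((\<lambda>j\<in>{1..n}. (color_shift m n i \<epsilon> j + a (prefix_reversal i j)) mod int m),
      prefix_reversal i \<circ> \<sigma>)"
    by (simp add: flip_stack_def a(1) mult_colored_perm_group inv_prefix_reversal)
  have pr: "prefix_reversal i permutes {1..n}" using i by (intro prefix_reversal_permutes) auto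
  show "flip_stack m n i \<epsilon> x \<in> ?X"
    unfolding flip carr using m permutes_compose[OF a(3) pr] by auto
  fix j assume j: "j \<in> {1..n}"
  have pj: "prefix_reversal i j = (if j \<le> i then i + 1 - j else j)" using j by (simp add: prefix_reversal_def)
  show "inv_into UNIV (snd (flip_stack m n i \<epsilon> x)) j
      = inv_into UNIV (snd x) (if j \<le> i then i + 1 - j else j)"
    unfolding flip snd_conv pj[symmetric] using a(1)
    by (simp add: o_inv_distrib permutes_bij[OF a(3)] permutes_bij[OF pr] inv_prefix_reversal)
  have "prefix_reversal i j \<in> {1..n}" using permutes_in_image[OF pr] j by simp
  then have "a (prefix_reversal i j) \<in> {0..<int m}" using a(2) by (rule PiE_mem[rotated])
  then show "fst (flip_stack m n i \<epsilon> x) j = (if j \<le> i then (fst x (i + 1 - j) + \<epsilon>) mod int m else fst x j)"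
    unfolding flip using j pj by (auto simp: color_shift_def a(1) mod_simps add.commute)
next
  have m: "0 < m" using assms by simp
  let ?X = "carrier (colored_perm_group m n)"
  note carr = carrier_colored_perm_group[OF m]
  fix x assume x: "x \<in> ?X"
  show "bij_betw (inv_into UNIV (snd x)) {1..n} {1..n}"
    by (rule permutes_imp_bij[OF permutes_inv]) (use x in \<open>auto simp: carr\<close>)
  show "fst x j \<in> {0..<int m}" if "j \<in> {1..n}" for j
    using x that unfolding carr by (auto dest!: PiE_mem)
  fix y assume y: "y \<in> ?X" and lab: "\<And>j. j \<in> {1..n} \<Longrightarrow> inv_into UNIV (snd x) j = inv_into UNIV (snd y) j"
    and col: "\<And>j. j \<in> {1..n} \<Longrightarrow> fst x j = fst y j"
  have px: "snd x permutes {1..n}" "snd y permutes {1..n}" using x y unfolding carr by auto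
  have "inv_into UNIV (snd x) = inv_into UNIV (snd y)"
  proof
    fix j show "inv_into UNIV (snd x) j = inv_into UNIV (snd y) j"
      using lab permutes_inv[OF px(1)] permutes_inv[OF px(2)]
      by (cases "j \<in> {1..n}") (auto simp: permutes_def)
  qed
  then have "snd x = snd y" using permutes_inv_inv[OF px(1)] permutes_inv_inv[OF px(2)] by metis
  moreover have "fst x = fst y"
    by (rule PiE_ext[of _ "{1..n}" "\<lambda>_. {0..<int m}"]) (use x y col in \<open>auto simp: carr\<close>)
  ultimately show "x = y" by (rule prod_eqI[rotated])
qed

lemma pancake_graph_gap_bounds:
  assumes "2 \<le> m" "2 \<le> n"
  shows "gap_const m / real n \<le> spectral_gap (pancake_graph m n)"
    and "spectral_gap (pancake_graph m n) \<le> 1 / real n"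
proof -
  interpret colored_stacks "carrier (colored_perm_group m n)" m n
    "\<lambda>x. inv_into UNIV (snd x)" fst "flip_stack m n"
    by (rule colored_stacks_colored_perm_group) fact
  have "pancake_graph m n = (carrier (colored_perm_group m n),
      {{x, y} | x y. x \<in> carrier (colored_perm_group m n) \<and> y \<in> nbrs x})"
    unfolding pancake_graph_def cayley_graph_def generalized_prefix_reversals_def in_nbrs flip_stack_def
    by (intro arg_cong2[of _ _ _ _ Pair] refl set_eqI) blast
  then show "gap_const m / real n \<le> spectral_gap (pancake_graph m n)"
    "spectral_gap (pancake_graph m n) \<le> 1 / real n"
    using spectral_gap_bounds[OF assms(2)] by simp_all
qed

theorem theorem1p1:
  shows "(\<forall>m n :: nat. 2 \<le> m \<longrightarrow> 2 \<le> n \<longrightarrow>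
            gap_const m / real n \<le> spectral_gap (pancake_graph m n) \<and>
            spectral_gap (pancake_graph m n) \<le> 1 / real n)
       \<and> (\<forall>m :: nat. 2 \<le> m \<longrightarrow>
            (\<exists>c C :: real. 0 < c \<and> 0 < C \<and>
              (\<forall>\<^sub>F n in sequentially.
                 c * (1 / real n) \<le> spectral_gap (pancake_graph m n) \<and>
                 spectral_gap (pancake_graph m n) \<le> C * (1 / real n))))"
proof -
  have "\<exists>c C :: real. 0 < c \<and> 0 < C \<and>
              (\<forall>\<^sub>F n in sequentially.
                 c * (1 / real n) \<le> spectral_gap (pancake_graph m n) \<and>
                 spectral_gap (pancake_graph m n) \<le> C * (1 / real n))" if m: "2 \<le> m" for m
    using gap_const_pos[OF m] pancake_graph_gap_bounds[OF m]
    by (intro exI[of _ "gap_const m"] exI[of _ 1] conjI eventually_sequentiallyI[of 2]) auto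
  with pancake_graph_gap_bounds show ?thesis by blast
qed

end
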